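(* Let $R,L>0$, let $f\in\mathscr{S}(\mathbb{R}^2)$ and let $g(x,r)=\frac1{2\pi}\int_{S^1}f(x+r\xi,r\eta)\,dS_1(\xi,\eta)$. 1. $G_{even}^{k,l}$ is well defined for all $k,l\in\mathbb{N}_0$, and if $0<r<R$, $0<x<L$, and $g$ is even in $x$, then $$g(x,r)=\sum_{k,l=0}^\infty i_{even}^{k,l}(x,r)\,G_{even}^{k,l}.$$ 2. $G_{odd}^{k,l}$ is well defined for all $k,l\in\mathbb{N}_0$, and if $0<r<R$, $0<x<L$, and $g$ is odd in $x$, then $$g(x,r)=\sum_{k,l=0}^\infty i_{odd}^{k,l}(x,r)\,G_{odd}^{k,l}.$$
   Context: $S^1\subset\mathbb{R}^2$ is the unit circle with canonical arc-length measure $S_1$; $\mathscr{S}$ is the Schwartz space; $\mathbb{N}_0=\{0,1,2,\dots\}$; $\chi_{(a,b)}$ is the characteristic function of $(a,b)$. Neumann's numbers: $\epsilon_0=1$, $\epsilon_k=2$ for $k\ge1$. For $k,l\in\mathbb{N}_0$, $$i_{even}^{k,l}(x,r)=\chi_{(0,L)}(x)\chi_{(0,R)}(r)\frac{\cos(k\frac{\pi}{L}\sqrt{L^2-x^2})}{\sqrt{L^2-x^2}}\frac{\cos(l\frac{\pi}{R}\sqrt{R^2-r^2})}{\sqrt{R^2-r^2}},\qquad i_{odd}^{k,l}(x,r)=x\,i_{even}^{k,l}(x,r).$$ Scalar products: $\langle u,v\rangle_{i_{even}}=\int_0^R\int_0^L u(x,r)v(x,r)\,r\sqrt{R^2-r^2}\;x\sqrt{L^2-x^2}\,dx\,dr$,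 $\langle u,v\rangle_{i_{odd}}=\int_0^R\int_0^L u(x,r)v(x,r)\,r\sqrt{R^2-r^2}\,\frac{\sqrt{L^2-x^2}}{x}\,dx\,dr$. Coefficients: $G_{even}^{k,l}=\frac{\epsilon_k\epsilon_l}{2LR}\langle i_{even}^{k,l}(x,r),\,g(x,r)+g(-x,r)\rangle_{i_{even}}$, $G_{odd}^{k,l}=\frac{\epsilon_k\epsilon_l}{2LR}\langle i_{odd}^{k,l}(x,r),\,g(x,r)-g(-x,r)\rangle_{i_{odd}}$. "Well defined" means that the defining integrals are finite. *)

theory Defs
  imports "HOL-Analysis.Analysis"
begin

definition partial_deriv ::
  "'a::euclidean_space \<Rightarrow> ('a \<Rightarrow> 'b::real_normed_vector) \<Rightarrow> 'a \<Rightarrow> 'b" where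
  "partial_deriv v f p = frechet_derivative f (at p) v"

text \<open>A list of basis vectors plays the role of a multi-index. Requiring that every iterated
  partial derivative (in every order of differentiation) is totally differentiable everywhere
  amounts to smoothness, and ensures that no unspecified value of \<^const>\<open>frechet_derivative\<close>
  is ever used in the decay condition.\<close>

definition schwartz_space :: "('a::euclidean_space \<Rightarrow> 'b::real_normed_vector) set" where
  "schwartz_space = {f. \<forall>vs. set vs \<subseteq> Basis \<longrightarrow>
     (\<forall>p. foldr partial_deriv vs f differentiable (at p)) \<and>
     (\<forall>n::nat. bounded (range (\<lambda>p. norm p ^ n *\<^sub>R foldr partial_deriv vs f p)))}"

text \<open>Arc length on the unit circle, as the image of Lebesgue measure under the unit-speed
  parametrization.\<close>

definition circle_measure :: "(real \<times> real) measure" where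
  "circle_measure = distr (restrict_space lborel {0..<2 * pi}) borel (\<lambda>t. (cos t, sin t))"

definition circular_mean :: "(real \<times> real \<Rightarrow> complex) \<Rightarrow> real \<Rightarrow> real \<Rightarrow> complex" where
  "circular_mean f x r =
     of_real (1 / (2 * pi)) * (LINT (\<xi>, \<eta>)|circle_measure. f (x + r * \<xi>, r * \<eta>))"

definition neumann_number :: "nat \<Rightarrow> real" where
  "neumann_number k = (if k = 0 then 1 else 2)"

definition i_even :: "real \<Rightarrow> real \<Rightarrow> nat \<Rightarrow> nat \<Rightarrow> real \<Rightarrow> real \<Rightarrow> real" where
  "i_even L R k l x r = indicator {0<..<L} x * indicator {0<..<R} r *
     (cos (real k * (pi / L) * sqrt (L\<^sup>2 - x\<^sup>2)) / sqrt (L\<^sup>2 - x\<^sup>2)) *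
     (cos (real l * (pi / R) * sqrt (R\<^sup>2 - r\<^sup>2)) / sqrt (R\<^sup>2 - r\<^sup>2))"

definition i_odd :: "real \<Rightarrow> real \<Rightarrow> nat \<Rightarrow> nat \<Rightarrow> real \<Rightarrow> real \<Rightarrow> real" where
  "i_odd L R k l x r = x * i_even L R k l x r"

definition iterated_integral :: "real \<Rightarrow> real \<Rightarrow> (real \<Rightarrow> real \<Rightarrow> complex) \<Rightarrow> complex" where
  "iterated_integral L R h = (LBINT r:{0<..<R}. (LBINT x:{0<..<L}. h x r))"

text \<open>The inner integral, the outer integral, and the double integral over the rectangle all
  converge absolutely. (The Bochner integral is total, so the finiteness of
  \<^const>\<open>iterated_integral\<close> has to be stated separately.)\<close>

definition iterated_integral_exists ::
  "real \<Rightarrow> real \<Rightarrow> (real \<Rightarrow> real \<Rightarrow> complex) \<Rightarrow> bool" where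
  "iterated_integral_exists L R h \<longleftrightarrow>
     (\<forall>r\<in>{0<..<R}. set_integrable lborel {0<..<L} (\<lambda>x. h x r)) \<and>
     set_integrable lborel {0<..<R} (\<lambda>r. LBINT x:{0<..<L}. h x r) \<and>
     set_integrable lborel ({0<..<L} \<times> {0<..<R}) (\<lambda>(x, r). h x r)"

text \<open>The scalar products are bilinear (no conjugation), also for complex-valued functions.\<close>

definition integrand_even :: "real \<Rightarrow> real \<Rightarrow> (real \<Rightarrow> real \<Rightarrow> complex) \<Rightarrow>
    (real \<Rightarrow> real \<Rightarrow> complex) \<Rightarrow> real \<Rightarrow> real \<Rightarrow> complex" where
  "integrand_even L R u v x r =
     u x r * v x r * of_real (r * sqrt (R\<^sup>2 - r\<^sup>2) * (x * sqrt (L\<^sup>2 - x\<^sup>2)))"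

definition integrand_odd :: "real \<Rightarrow> real \<Rightarrow> (real \<Rightarrow> real \<Rightarrow> complex) \<Rightarrow>
    (real \<Rightarrow> real \<Rightarrow> complex) \<Rightarrow> real \<Rightarrow> real \<Rightarrow> complex" where
  "integrand_odd L R u v x r =
     u x r * v x r * of_real (r * sqrt (R\<^sup>2 - r\<^sup>2) * (sqrt (L\<^sup>2 - x\<^sup>2) / x))"

definition scalar_even :: "real \<Rightarrow> real \<Rightarrow> (real \<Rightarrow> real \<Rightarrow> complex) \<Rightarrow>
    (real \<Rightarrow> real \<Rightarrow> complex) \<Rightarrow> complex" where
  "scalar_even L R u v = iterated_integral L R (integrand_even L R u v)"

definition scalar_odd :: "real \<Rightarrow> real \<Rightarrow> (real \<Rightarrow> real \<Rightarrow> complex) \<Rightarrow>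
    (real \<Rightarrow> real \<Rightarrow> complex) \<Rightarrow> complex" where
  "scalar_odd L R u v = iterated_integral L R (integrand_odd L R u v)"

definition G_even ::
  "real \<Rightarrow> real \<Rightarrow> (real \<Rightarrow> real \<Rightarrow> complex) \<Rightarrow> nat \<Rightarrow> nat \<Rightarrow> complex" where
  "G_even L R g k l = of_real (neumann_number k * neumann_number l / (2 * L * R)) *
     scalar_even L R (\<lambda>x r. of_real (i_even L R k l x r)) (\<lambda>x r. g x r + g (- x) r)"

definition G_odd ::
  "real \<Rightarrow> real \<Rightarrow> (real \<Rightarrow> real \<Rightarrow> complex) \<Rightarrow> nat \<Rightarrow> nat \<Rightarrow> complex" where
  "G_odd L R g k l = of_real (neumann_number k * neumann_number l / (2 * L * R)) *
     scalar_odd L R (\<lambda>x r. of_real (i_odd L R k l x r)) (\<lambda>x r. g x r - g (- x) r)"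

definition G_even_well_defined ::
  "real \<Rightarrow> real \<Rightarrow> (real \<Rightarrow> real \<Rightarrow> complex) \<Rightarrow> nat \<Rightarrow> nat \<Rightarrow> bool" where
  "G_even_well_defined L R g k l \<longleftrightarrow> iterated_integral_exists L R
     (integrand_even L R (\<lambda>x r. of_real (i_even L R k l x r)) (\<lambda>x r. g x r + g (- x) r))"

definition G_odd_well_defined ::
  "real \<Rightarrow> real \<Rightarrow> (real \<Rightarrow> real \<Rightarrow> complex) \<Rightarrow> nat \<Rightarrow> nat \<Rightarrow> bool" where
  "G_odd_well_defined L R g k l \<longleftrightarrow> iterated_integral_exists L R
     (integrand_odd L R (\<lambda>x r. of_real (i_odd L R k l x r)) (\<lambda>x r. g x r - g (- x) r))"

end

theory Submission
  imports Defs
begin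

text \<open>
In each variable the functions \<^const>\<open>i_even\<close> are cosines in \<open>s = sqrt (L\<^sup>2 - x\<^sup>2)\<close> and \<open>t = sqrt (R\<^sup>2 - r\<^sup>2)\<close>,
divided by \<open>s\<close> and \<open>t\<close>. The weights of the scalar product are made for the substitution \<open>s ds = - x dx\<close>: the even expansion of \<open>g\<close>
is the double cosine series of \<open>s * t * g (sqrt (L\<^sup>2 - s\<^sup>2)) (sqrt (R\<^sup>2 - t\<^sup>2))\<close> on a rectangle, divided by
\<open>s * t\<close>. So two things are needed: cosine series with absolutely summable coefficients represent continuous
functions (\<open>cosine_series_has_sum\<close>), and the coefficients decay.

The substitution is singular at \<open>x = 0\<close>, that is at \<open>s = L\<close>, so bounds for the derivatives of a function
in \<open>x\<close> do not by themselves bound its derivatives in \<open>s\<close>. This is where parity enters: if the derivative of \<open>\<phi>\<close> vanishes at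
\<open>0\<close>, then dividing it by \<open>x\<close> leaves a smooth function (\<open>hadamard_lemma\<close>), and two integrations by
parts bound the coefficient of index \<open>k\<close> by a constant times \<open>1 / (k + 1)\<^sup>2\<close>, the constant depending only on the interval and on bounds for the first
three derivatives of \<open>\<phi>\<close> and for \<open>\<phi>\<close> itself (\<open>norm_chord_transform_le\<close>). Applied first in \<open>x\<close> and then in \<open>r\<close>, this gives the
bound \<open>1 / ((k + 1)\<^sup>2 * (l + 1)\<^sup>2)\<close> up to a constant, hence unconditional convergence of the double series
(\<open>chord_double_series_has_sum\<close>).

The circular mean \<open>g\<close> is smooth by differentiation under the integral (\<open>is_jet2_circle_jet\<close>). Its
\<open>r\<close>-derivative vanishes at \<open>r = 0\<close> because \<open>cos\<close> and \<open>sin\<close> have mean zero over the circle; its \<open>x\<close>-derivative vanishes at \<open>x = 0\<close> if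
\<open>g\<close> is even in \<open>x\<close>. If \<open>g\<close> is odd in \<open>x\<close>, the same argument applies to the even function \<open>g x r / x\<close>, which is smooth
by Hadamard's lemma, and multiplying its expansion by \<open>x\<close> gives the odd expansion of \<open>g\<close>.
\<close>

section \<open>Cosine series with absolutely summable coefficients\<close>

lemma has_integral_cos_multiple:
  fixes n :: int
  assumes "A > 0"
  shows "((\<lambda>s. cos (of_int n * (pi / A) * s)) has_integral (if n = 0 then A else 0)) {0..A}"
proof (cases "n = 0")
  case True
  then show ?thesis
    using has_integral_const_real[of "1::real" 0 A] assms by simp
next
  case False
  define w where "w = of_int n * (pi / A)"
  have w: "w \<noteq> 0" using False assms by (simp add: w_def)
  have "((\<lambda>s. cos (w * s)) has_integral (sin (w * A) / w - sin (w * 0) / w)) {0..A}"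
    by (rule fundamental_theorem_of_calculus)
      (use assms w in \<open>auto intro!: derivative_eq_intros
          simp: has_real_derivative_iff_has_vector_derivative[symmetric]\<close>)
  moreover have "w * A = pi * of_int n" using assms by (simp add: w_def)
  ultimately show ?thesis using False by (simp add: w_def)
qed

lemma cosine_orthogonality:
  assumes "A > 0"
  shows "((\<lambda>s. cos (real k * (pi / A) * s) * cos (real j * (pi / A) * s))
    has_integral (if k = j then A / neumann_number k else 0)) {0..A}"
proof -
  have eq: "cos (real k * (pi / A) * s) * cos (real j * (pi / A) * s) =
      (cos (of_int (int k - int j) * (pi / A) * s) + cos (of_int (int k + int j) * (pi / A) * s)) / 2"
    for s
    by (subst cos_times_cos) (simp add: algebra_simps)
  have "((if int k - int j = 0 then A else 0) + (if int k + int j = 0 then A else 0)) / 2 =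
      (if k = j then A / neumann_number k else 0)"
    by (auto simp: neumann_number_def)
  then show ?thesis
    unfolding eq
    using has_integral_divide[OF has_integral_add[OF
        has_integral_cos_multiple[OF assms, of "int k - int j"]
        has_integral_cos_multiple[OF assms, of "int k + int j"]], of 2]
    by (simp only:)
qed

text \<open>By the product formula for cosines, multiplication by the cosine of frequency one turns a cosine moment into the
mean of its two neighbours, so vanishing moments stay zero under multiplication by any power of it.\<close>

lemma integral_cos_power_zero:
  fixes u :: "real \<Rightarrow> real"
  assumes "A > 0" and u: "continuous_on {0..A} u"
    and zero: "\<And>k. integral {0..A} (\<lambda>s. cos (real k * (pi / A) * s) * u s) = 0"
  shows "integral {0..A} (\<lambda>s. cos (pi / A * s) ^ n * (cos (real k * (pi / A) * s) * u s)) = 0"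
proof (induction n arbitrary: k)
  case 0
  then show ?case using zero by simp
next
  case (Suc n)
  have int: "(\<lambda>s. cos (pi / A * s) ^ n * (cos (real j * (pi / A) * s) * u s)) integrable_on {0..A}" for j
    by (intro integrable_continuous_interval continuous_intros u)
  show ?case
  proof (cases k)
    case 0
    show ?thesis
      using Suc.IH[of 1] by (simp add: 0 algebra_simps)
  next
    case k: (Suc m)
    have prod: "cos (pi / A * s) * cos (real k * (pi / A) * s) =
      (cos (real m * (pi / A) * s) + cos (real (Suc k) * (pi / A) * s)) / 2" for s
      unfolding k by (subst mult.commute, subst cos_times_cos) (simp add: algebra_simps add_divide_distrib)
    have "cos (pi / A * s) ^ Suc n * (cos (real k * (pi / A) * s) * u s) =
      cos (pi / A * s) ^ n * ((cos (pi / A * s) * cos (real k * (pi / A) * s)) * u s)" for s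
      by simp
    then have step: "cos (pi / A * s) ^ Suc n * (cos (real k * (pi / A) * s) * u s) =
      (cos (pi / A * s) ^ n * (cos (real m * (pi / A) * s) * u s) +
       cos (pi / A * s) ^ n * (cos (real (Suc k) * (pi / A) * s) * u s)) / 2" for s
      unfolding prod by (simp add: ring_distribs)
    show ?thesis
      unfolding step by (simp only: integral_divide integral_add[OF int int] Suc.IH) simp
  qed
qed

text \<open>In the variable $y = \cos(\pi s/A)$ the function is continuous on $[-1,1]$, and the moments say that it is
orthogonal to every polynomial in $y$. By the Weierstrass theorem it is then orthogonal to itself.\<close>

lemma cosine_moments_determine_real:
  fixes u :: "real \<Rightarrow> real"
  assumes A: "A > 0" and u: "continuous_on {0..A} u"
    and zero: "\<And>k. integral {0..A} (\<lambda>s. cos (real k * (pi / A) * s) * u s) = 0"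
    and s: "s \<in> {0..A}"
  shows "u s = 0"
proof -
  define U where "U = (\<lambda>y. u (A / pi * arccos y))"
  have "arccos y / pi \<le> 1" if "y \<in> {-1..1}" for y using arccos_ubound[of y] that by auto
  then have "A * (arccos y / pi) \<le> A * 1" if "y \<in> {-1..1}" for y
    using A that by (intro mult_left_mono) auto
  then have U: "continuous_on {-1..1} U"
    unfolding U_def using A
    by (intro continuous_on_compose2[OF u] continuous_intros) (auto simp: arccos_lbound)
  define B where "B = integral {0..A} (\<lambda>s. \<bar>u s\<bar>)"
  have B: "B \<ge> 0" unfolding B_def by (rule integral_nonneg) (auto intro!: integrable_continuous_interval continuous_intros u)
  have small: "integral {0..A} (\<lambda>s. u s * u s) \<le> e * B" if "e > 0" for e
  proof -
    obtain p where p: "real_polynomial_function p" and pU: "\<And>y. y \<in> {-1..1} \<Longrightarrow> \<bar>U y - p y\<bar> < e"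
      using Stone_Weierstrass_real_polynomial_function[OF _ U \<open>e > 0\<close>] by auto
    obtain a n where pa: "p = (\<lambda>x. \<Sum>i\<le>n. a i * x ^ i)"
      using p real_polynomial_function_iff_sum by auto
    define q where "q = (\<lambda>s. p (cos (pi / A * s)))"
    have contq: "continuous_on {0..A} q"
      unfolding q_def pa by (intro continuous_intros)
    have "integral {0..A} (\<lambda>s. q s * u s) = integral {0..A} (\<lambda>s. \<Sum>i\<le>n. a i * (cos (pi / A * s) ^ i * u s))"
      by (simp add: q_def pa sum_distrib_right mult.assoc)
    also have "\<dots> = (\<Sum>i\<le>n. integral {0..A} (\<lambda>s. a i * (cos (pi / A * s) ^ i * u s)))"
      by (intro integral_sum integrable_continuous_interval continuous_intros u) auto
    also have "\<dots> = 0"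
      using integral_cos_power_zero[OF A u zero, of _ 0] by simp
    finally have qu: "integral {0..A} (\<lambda>s. q s * u s) = 0" .
    have "integral {0..A} (\<lambda>s. u s * u s) = integral {0..A} (\<lambda>s. u s * u s) - integral {0..A} (\<lambda>s. q s * u s)"
      using qu by simp
    also have "\<dots> = integral {0..A} (\<lambda>s. u s * u s - q s * u s)"
      by (intro integral_diff[symmetric] integrable_continuous_interval continuous_intros u contq)
    also have "\<dots> \<le> integral {0..A} (\<lambda>s. e * \<bar>u s\<bar>)"
    proof (intro integral_le integrable_continuous_interval continuous_intros u contq)
      fix s assume s: "s \<in> {0..A}"
      have "pi / A * s \<le> pi * 1" using s A by (auto simp: field_simps)
      then have "U (cos (pi / A * s)) = u s"
        unfolding U_def using s A by (subst arccos_cos) auto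
      then have "\<bar>u s - q s\<bar> \<le> e"
        using pU[of "cos (pi / A * s)"] by (simp add: q_def)
      then have "\<bar>u s - q s\<bar> * \<bar>u s\<bar> \<le> e * \<bar>u s\<bar>"
        by (rule mult_right_mono) simp
      then have "\<bar>(u s - q s) * u s\<bar> \<le> e * \<bar>u s\<bar>"
        by (simp add: abs_mult)
      then show "u s * u s - q s * u s \<le> e * \<bar>u s\<bar>"
        by (simp add: left_diff_distrib)
    qed
    finally show ?thesis by (simp add: B_def)
  qed
  have "integral {0..A} (\<lambda>s. u s * u s) \<le> 0"
  proof (rule field_le_epsilon)
    fix e :: real assume "e > 0"
    then have "integral {0..A} (\<lambda>s. u s * u s) \<le> e / (B + 1) * B"
      using B by (intro small) simp
    also have "\<dots> \<le> e" using B \<open>e > 0\<close> by (simp add: field_simps)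
    finally show "integral {0..A} (\<lambda>s. u s * u s) \<le> 0 + e" by simp
  qed
  moreover have "integral {0..A} (\<lambda>s. u s * u s) \<ge> 0"
    by (rule integral_nonneg) (auto intro!: integrable_continuous_interval continuous_intros u)
  ultimately have "integral {0..A} (\<lambda>s. u s * u s) = 0" by simp
  moreover have "continuous_on {0..A} (\<lambda>s. u s * u s)"
    by (intro continuous_intros u)
  ultimately have "\<forall>s\<in>{0..A}. u s * u s = 0"
    by (subst (asm) integral_eq_0_iff) (use A in auto)
  then show ?thesis using s by simp
qed

lemma cosine_moments_determine:
  fixes u :: "real \<Rightarrow> complex"
  assumes A: "A > 0" and u: "continuous_on {0..A} u"
    and zero: "\<And>k. integral {0..A} (\<lambda>s. cos (real k * (pi / A) * s) *\<^sub>R u s) = 0"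
    and s: "s \<in> {0..A}"
  shows "u s = 0"
proof -
  have int: "(\<lambda>s. cos (real k * (pi / A) * s) *\<^sub>R u s) integrable_on {0..A}" for k
    by (intro integrable_continuous_interval continuous_intros u)
  have "Re (u s) = 0"
  proof (rule cosine_moments_determine_real[OF A _ _ s])
    show "continuous_on {0..A} (\<lambda>s. Re (u s))" by (intro continuous_intros u)
    show "integral {0..A} (\<lambda>s. cos (real k * (pi / A) * s) * Re (u s)) = 0" for k
      using integral_linear[OF int bounded_linear_Re, of k] zero[of k] by (simp add: o_def)
  qed
  moreover have "Im (u s) = 0"
  proof (rule cosine_moments_determine_real[OF A _ _ s])
    show "continuous_on {0..A} (\<lambda>s. Im (u s))" by (intro continuous_intros u)
    show "integral {0..A} (\<lambda>s. cos (real k * (pi / A) * s) * Im (u s)) = 0" for k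
      using integral_linear[OF int bounded_linear_Im, of k] zero[of k] by (simp add: o_def)
  qed
  ultimately show ?thesis by (simp add: complex_eq_iff)
qed

lemma neumann_number_pos: "neumann_number k > 0" and neumann_number_le_2: "neumann_number k \<le> 2"
  by (auto simp: neumann_number_def)

text \<open>Absolutely summable coefficients make the series converge uniformly, so its sum is continuous and, by
orthogonality, has the same cosine moments as \<open>u\<close>. Continuous functions with equal moments agree.\<close>

lemma cosine_series_has_sum:
  fixes A :: real and u :: "real \<Rightarrow> complex"
  defines "c \<equiv> (\<lambda>k. integral {0..A} (\<lambda>s. cos (real k * (pi / A) * s) *\<^sub>R u s))"
  assumes A: "A > 0" and u: "continuous_on {0..A} u"
    and summable: "summable (\<lambda>k. norm (c k))"
    and s: "s \<in> {0..A}"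
  shows "((\<lambda>k. (neumann_number k / A * cos (real k * (pi / A) * s)) *\<^sub>R c k) has_sum u s) UNIV"
proof -
  define f where "f = (\<lambda>k s. (neumann_number k / A * cos (real k * (pi / A) * s)) *\<^sub>R c k)"
  have f_le: "norm (f k s) \<le> 2 / A * norm (c k)" for k s
  proof -
    have "\<bar>neumann_number k / A * cos (real k * (pi / A) * s)\<bar> =
        neumann_number k / A * \<bar>cos (real k * (pi / A) * s)\<bar>"
      using neumann_number_pos[of k] A by (simp add: abs_mult)
    also have "\<dots> \<le> 2 / A * 1"
      using neumann_number_pos[of k] neumann_number_le_2[of k] A by (intro mult_mono divide_right_mono) auto
    finally show ?thesis unfolding f_def norm_scaleR by (intro mult_right_mono) auto
  qed
  have sum_f: "summable (\<lambda>k. norm (f k s))" for s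
    by (rule summable_comparison_test[OF _ summable_mult[OF summable, of "2 / A"]]) (use f_le in auto)
  define S where "S = (\<lambda>s. \<Sum>k. f k s)"
  have lim: "uniform_limit {0..A} (\<lambda>n s. \<Sum>k<n. f k s) S sequentially"
    unfolding S_def using f_le summable_mult[OF summable, of "2 / A"] by (rule Weierstrass_m_test)
  have contf: "continuous_on {0..A} (f k)" for k
    unfolding f_def by (intro continuous_intros)
  have contS: "continuous_on {0..A} S"
    by (rule uniform_limit_theorem[OF _ lim])
      (auto intro!: always_eventually continuous_intros contf)
  have moments: "integral {0..A} (\<lambda>s. cos (real j * (pi / A) * s) *\<^sub>R S s) = c j" for j
  proof -
    define h where "h = (\<lambda>s. cos (real j * (pi / A) * s))"
    have "uniform_limit {0..A} (\<lambda>n s. h s *\<^sub>R (\<Sum>k<n. f k s)) (\<lambda>s. h s *\<^sub>R S s) sequentially"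
    proof (rule bounded_bilinear.bounded_uniform_limit[OF bounded_bilinear_scaleR])
      show "bounded (S ` {0..A})"
        using compact_continuous_image[OF contS] compact_imp_bounded by blast
      show "bounded (h ` {0..A})" unfolding h_def by (rule boundedI[of _ 1]) auto
    qed (use lim in \<open>auto intro!: uniform_limit_const\<close>)
    then obtain I J where I: "\<And>n. ((\<lambda>s. h s *\<^sub>R (\<Sum>k<n. f k s)) has_integral I n) {0..A}"
      and J: "((\<lambda>s. h s *\<^sub>R S s) has_integral J) {0..A}" and IJ: "I \<longlonglongrightarrow> J"
      by (rule uniform_limit_integral) (use A in \<open>auto simp: h_def intro!: continuous_intros contf\<close>)
    have I_eq: "I n = c j" if "n > j" for n
    proof -
      have orth: "((\<lambda>s. (neumann_number k / A) *\<^sub>R (cos (real k * (pi / A) * s) * h s) *\<^sub>R c k) has_integral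
          (neumann_number k / A) *\<^sub>R (if k = j then A / neumann_number k else 0) *\<^sub>R c k) {0..A}" for k
        unfolding h_def
        by (intro has_integral_cmul has_integral_scaleR_left cosine_orthogonality A)
      have "((\<lambda>s. \<Sum>k<n. (neumann_number k / A) *\<^sub>R (cos (real k * (pi / A) * s) * h s) *\<^sub>R c k) has_integral
          (\<Sum>k<n. (neumann_number k / A) *\<^sub>R (if k = j then A / neumann_number k else 0) *\<^sub>R c k)) {0..A}"
        by (intro has_integral_sum orth) auto
      moreover have "(\<Sum>k<n. (neumann_number k / A) *\<^sub>R (if k = j then A / neumann_number k else 0) *\<^sub>R c k)
          = (\<Sum>k<n. if k = j then c k else 0)"
        by (intro sum.cong) (use A neumann_number_pos[of j] in auto)
      moreover have "\<dots> = c j" using that by simp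
      moreover have "(\<lambda>s. \<Sum>k<n. (neumann_number k / A) *\<^sub>R (cos (real k * (pi / A) * s) * h s) *\<^sub>R c k) =
          (\<lambda>s. h s *\<^sub>R (\<Sum>k<n. f k s))"
        by (auto simp: f_def scaleR_sum_right mult_ac)
      ultimately show ?thesis using I[of n] has_integral_unique by metis
    qed
    have "I \<longlonglongrightarrow> c j"
      by (rule tendsto_eventually) (use I_eq in \<open>auto simp: eventually_at_top_dense\<close>)
    then have "J = c j" using IJ LIMSEQ_unique by blast
    then show ?thesis using J by (simp add: h_def integral_unique)
  qed
  have int: "(\<lambda>s. cos (real j * (pi / A) * s) *\<^sub>R v s) integrable_on {0..A}"
    if "continuous_on {0..A} v" for j and v :: "real \<Rightarrow> complex"
    by (intro integrable_continuous_interval continuous_intros that)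
  have "S s - u s = 0"
  proof (rule cosine_moments_determine[OF A _ _ s])
    show "continuous_on {0..A} (\<lambda>s. S s - u s)" by (intro continuous_intros contS u)
    show "integral {0..A} (\<lambda>s. cos (real k * (pi / A) * s) *\<^sub>R (S s - u s)) = 0" for k
      unfolding scaleR_diff_right
      by (subst integral_diff[OF int[OF contS] int[OF u]]) (simp only: moments, simp only: c_def diff_self)
  qed
  moreover have "(\<lambda>k. f k s) sums S s"
    unfolding S_def using summable_norm_cancel[OF sum_f] by (rule summable_sums)
  ultimately have "(\<lambda>k. f k s) sums u s" by simp
  then have "((\<lambda>k. f k s) has_sum u s) UNIV"
    by (rule norm_summable_imp_has_sum[OF sum_f])
  then show ?thesis by (simp add: f_def)
qed

section \<open>Cosine series in the variable $\sqrt{A^2-x^2}$\<close>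

text \<open>The inner product of \<open>\<phi>\<close> with one factor of \<^const>\<open>i_even\<close>: the weight
\<open>x * sqrt (A\<^sup>2 - x\<^sup>2)\<close> cancels the denominator. The name recalls that \<open>sqrt (A\<^sup>2 - x\<^sup>2)\<close> is half the
length of a chord of the circle of radius \<open>A\<close> at distance \<open>x\<close> from the centre.\<close>

definition chord_transform :: "real \<Rightarrow> nat \<Rightarrow> (real \<Rightarrow> complex) \<Rightarrow> complex" where
  "chord_transform A k \<phi> =
     integral {0..A} (\<lambda>x. (x * cos (real k * (pi / A) * sqrt (A\<^sup>2 - x\<^sup>2))) *\<^sub>R \<phi> x)"

lemma sqrt_diff_squares_DERIV:
  fixes A x :: real
  assumes "0 \<le> x" "x < A"
  shows "((\<lambda>x. sqrt (A\<^sup>2 - x\<^sup>2)) has_real_derivative (- x / sqrt (A\<^sup>2 - x\<^sup>2))) (at x within S)"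
proof -
  have "x\<^sup>2 < A\<^sup>2" using assms by (intro power_strict_mono) auto
  then show ?thesis
    by (auto intro!: derivative_eq_intros simp: field_simps)
qed

text \<open>The substitution \<open>s = sqrt (A\<^sup>2 - x\<^sup>2)\<close>, an involution of \<open>{0..A}\<close> with \<open>s ds = - x dx\<close>.\<close>

lemma chord_transform_eq_cosine_coefficient:
  assumes A: "A > 0" and \<phi>: "continuous_on {0..A} \<phi>"
  shows "chord_transform A k \<phi> =
    integral {0..A} (\<lambda>s. cos (real k * (pi / A) * s) *\<^sub>R (s *\<^sub>R \<phi> (sqrt (A\<^sup>2 - s\<^sup>2))))"
proof -
  define f where "f = (\<lambda>s. cos (real k * (pi / A) * s) *\<^sub>R \<phi> (sqrt (A\<^sup>2 - s\<^sup>2)))"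
  define F where "F = (\<lambda>s. s *\<^sub>R f s)"
  define s where "s = (\<lambda>x. sqrt (A\<^sup>2 - x\<^sup>2))"
  have s_range: "0 \<le> s x \<and> s x \<le> A" if "x \<in> {0..A}" for x
    using that A by (auto simp: s_def real_le_lsqrt power_mono)
  have s_s: "s (s x) = x" if "x \<in> {0..A}" for x
    using that by (simp add: s_def power_mono)
  have "continuous_on {0..A} (\<lambda>x. \<phi> (s x))"
    by (rule continuous_on_compose2[OF \<phi>]) (use s_range in \<open>auto simp: s_def intro!: continuous_intros\<close>)
  then have contf: "continuous_on {0..A} f"
    unfolding f_def by (intro continuous_intros) (auto simp: s_def)
  then have "continuous_on {0..A} F"
    unfolding F_def by (intro continuous_intros)
  then have "((\<lambda>x. (- x / s x) *\<^sub>R F (s x)) has_integral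
      integral {s 0..s A} F - integral {s A..s 0} F) {0..A}"
    using s_range A sqrt_diff_squares_DERIV[of _ A]
    by (intro has_integral_substitution_general[where s = "{A}" and c = 0 and d = A])
      (auto simp: s_def intro!: continuous_intros)
  moreover have "s 0 = A" "s A = 0" using A by (auto simp: s_def)
  moreover have "integral {A..0} F = 0" using A by simp
  ultimately have "((\<lambda>x. (- x / s x) *\<^sub>R F (s x)) has_integral - integral {0..A} F) {0..A}"
    by (simp only: diff_0)
  from has_integral_neg[OF this] have "((\<lambda>x. - ((- x / s x) *\<^sub>R F (s x))) has_integral integral {0..A} F) {0..A}"
    by (simp only: minus_minus)
  then have "((\<lambda>x. (x * cos (real k * (pi / A) * s x)) *\<^sub>R \<phi> x) has_integral integral {0..A} F) {0..A}"
  proof (rule has_integral_spike_finite[of "{A}", rotated 2])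
    fix x assume x: "x \<in> {0..A} - {A}"
    then have "x\<^sup>2 < A\<^sup>2" by (intro power_strict_mono) auto
    then have "s x \<noteq> 0" by (simp add: s_def)
    moreover have "sqrt (A\<^sup>2 - (s x)\<^sup>2) = x" using s_s[of x] x by (auto simp: s_def)
    ultimately show "(x * cos (real k * (pi / A) * s x)) *\<^sub>R \<phi> x = - ((- x / s x) *\<^sub>R F (s x))"
      by (simp add: F_def f_def)
  qed auto
  then have "chord_transform A k \<phi> = integral {0..A} F"
    unfolding chord_transform_def s_def by (rule integral_unique)
  also have "F = (\<lambda>s. cos (real k * (pi / A) * s) *\<^sub>R (s *\<^sub>R \<phi> (sqrt (A\<^sup>2 - s\<^sup>2))))"
    by (auto simp: F_def f_def)
  finally show ?thesis .
qed

text \<open>The cosine series of \<open>s *\<^sub>R \<phi> (sqrt (A\<^sup>2 - s\<^sup>2))\<close>, divided by \<open>s\<close>; this is why the endpoint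
\<open>x = A\<close> has to be left out.\<close>

lemma chord_series_has_sum:
  assumes A: "A > 0" and \<phi>: "continuous_on {0..A} \<phi>"
    and summable: "summable (\<lambda>k. norm (chord_transform A k \<phi>))"
    and x: "0 < x" "x < A"
  shows "((\<lambda>k. (neumann_number k / A * (cos (real k * (pi / A) * sqrt (A\<^sup>2 - x\<^sup>2)) / sqrt (A\<^sup>2 - x\<^sup>2)))
            *\<^sub>R chord_transform A k \<phi>) has_sum \<phi> x) UNIV"
proof -
  define s where "s = sqrt (A\<^sup>2 - x\<^sup>2)"
  have x2: "x\<^sup>2 < A\<^sup>2" using x by (intro power_strict_mono) auto
  have s: "0 < s" "s \<le> A" "sqrt (A\<^sup>2 - s\<^sup>2) = x"
    using x A x2 by (auto simp: s_def real_le_lsqrt)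
  have "continuous_on {0..A} (\<lambda>s. s *\<^sub>R \<phi> (sqrt (A\<^sup>2 - s\<^sup>2)))"
    using A by (intro continuous_intros continuous_on_compose2[OF \<phi>])
      (auto simp: real_le_lsqrt power_mono)
  then have "((\<lambda>k. (neumann_number k / A * cos (real k * (pi / A) * s)) *\<^sub>R chord_transform A k \<phi>)
      has_sum s *\<^sub>R \<phi> (sqrt (A\<^sup>2 - s\<^sup>2))) UNIV"
    unfolding chord_transform_eq_cosine_coefficient[OF A \<phi>]
    by (rule cosine_series_has_sum[OF A])
      (use s summable in \<open>auto simp: chord_transform_eq_cosine_coefficient[OF A \<phi>]\<close>)
  then have "((\<lambda>k. (1 / s) *\<^sub>R (neumann_number k / A * cos (real k * (pi / A) * s)) *\<^sub>R chord_transform A k \<phi>)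
      has_sum (1 / s) *\<^sub>R s *\<^sub>R \<phi> (sqrt (A\<^sup>2 - s\<^sup>2))) UNIV"
    by (rule has_sum_scaleR)
  then show ?thesis using s by (simp add: s_def[symmetric] mult.commute)
qed

section \<open>Smooth functions and division by the variable\<close>

text \<open>Smooth functions are carried around together with all their derivatives, \<open>\<phi> i\<close> being the \<open>i\<close>-th one. For functions
given by parameter integrals the derivatives are then again explicit integrals, which can be estimated.\<close>

definition is_jet :: "(nat \<Rightarrow> real \<Rightarrow> complex) \<Rightarrow> bool" where
  "is_jet \<phi> \<longleftrightarrow> (\<forall>i x. (\<phi> i has_vector_derivative \<phi> (Suc i) x) (at x))"

lemma is_jet_continuous_on: "is_jet \<phi> \<Longrightarrow> continuous_on S (\<phi> i)"
  unfolding is_jet_def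
  by (meson continuous_at_imp_continuous_on has_vector_derivative_continuous)

text \<open>These are the successive derivatives of \<open>\<lambda>x. integral {0..1} (\<lambda>\<tau>. \<phi> 0 (\<tau> * x))\<close>.\<close>

definition ray_average :: "(nat \<Rightarrow> real \<Rightarrow> complex) \<Rightarrow> nat \<Rightarrow> real \<Rightarrow> complex" where
  "ray_average \<phi> i x = integral {0..1} (\<lambda>\<tau>. \<tau> ^ i *\<^sub>R \<phi> i (\<tau> * x))"

lemma is_jet_chain_rule:
  assumes "is_jet \<phi>"
  shows "((\<lambda>x. \<phi> i (\<tau> * x)) has_vector_derivative \<tau> *\<^sub>R \<phi> (Suc i) (\<tau> * x)) (at x within S)"
proof -
  have "((\<lambda>x. \<tau> * x) has_vector_derivative \<tau>) (at x within S)"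
    by (auto intro!: derivative_eq_intros)
  moreover have "(\<phi> i has_vector_derivative \<phi> (Suc i) (\<tau> * x)) (at (\<tau> * x) within (*) \<tau> ` S)"
    using assms by (auto simp: is_jet_def intro: has_vector_derivative_at_within)
  ultimately show ?thesis
    using vector_diff_chain_within[of "(*) \<tau>" \<tau> x S "\<phi> i" "\<phi> (Suc i) (\<tau> * x)"]
    by (simp add: o_def)
qed

lemma is_jet_ray_average:
  assumes "is_jet \<phi>"
  shows "is_jet (ray_average \<phi>)"
  unfolding is_jet_def
proof (intro allI)
  fix i x
  have cont: "continuous_on UNIV (\<phi> j)" for j
    by (rule is_jet_continuous_on[OF assms])
  have "((\<lambda>x. integral (cbox 0 1) (\<lambda>\<tau>. \<tau> ^ i *\<^sub>R \<phi> i (\<tau> * x))) has_vector_derivative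
      integral (cbox 0 1) (\<lambda>\<tau>. \<tau> ^ i *\<^sub>R \<tau> *\<^sub>R \<phi> (Suc i) (\<tau> * x))) (at x within UNIV)"
  proof (rule leibniz_rule_vector_derivative)
    show "((\<lambda>x. \<tau> ^ i *\<^sub>R \<phi> i (\<tau> * x)) has_vector_derivative
        \<tau> ^ i *\<^sub>R \<tau> *\<^sub>R \<phi> (Suc i) (\<tau> * y)) (at y within UNIV)" for y \<tau>
      using bounded_linear.has_vector_derivative[OF bounded_linear_scaleR_right
          is_jet_chain_rule[OF assms, of i \<tau> y UNIV], of "\<tau> ^ i"] by simp
    show "(\<lambda>\<tau>. \<tau> ^ i *\<^sub>R \<phi> i (\<tau> * y)) integrable_on cbox 0 1" for y
      by (intro integrable_continuous continuous_intros continuous_on_compose2[OF cont]) auto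
    show "continuous_on (UNIV \<times> cbox 0 1) (\<lambda>(x, \<tau>). \<tau> ^ i *\<^sub>R \<tau> *\<^sub>R \<phi> (Suc i) (\<tau> * x))"
      unfolding case_prod_unfold
      by (intro continuous_intros continuous_on_compose2[OF cont]) auto
  qed auto
  then show "(ray_average \<phi> i has_vector_derivative ray_average \<phi> (Suc i) x) (at x)"
    by (simp add: ray_average_def[abs_def] mult.commute)
qed

text \<open>The fundamental theorem of calculus along the segment from \<open>0\<close> to \<open>x\<close>. It divides a smooth
function that vanishes at the origin by \<open>x\<close> without leaving the smooth functions.\<close>

lemma hadamard_lemma:
  assumes "is_jet \<phi>"
  shows "x *\<^sub>R ray_average (\<lambda>i. \<phi> (Suc i)) 0 x = \<phi> 0 x - \<phi> 0 0"
proof -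
  have "((\<lambda>\<tau>. x *\<^sub>R \<phi> (Suc 0) (x * \<tau>)) has_integral \<phi> 0 (x * 1) - \<phi> 0 (x * 0)) {0..1}"
    by (rule fundamental_theorem_of_calculus) (auto intro: is_jet_chain_rule[OF assms])
  then show ?thesis
    by (simp add: ray_average_def integral_unique mult.commute flip: integral_cmul)
qed

lemma norm_ray_average_le:
  assumes "is_jet \<phi>" and M: "\<And>y. y \<in> {0..A} \<Longrightarrow> norm (\<phi> i y) \<le> M" and x: "x \<in> {0..A}"
  shows "norm (ray_average \<phi> i x) \<le> M"
proof -
  have "norm (ray_average \<phi> i x) \<le> M * (1 - 0)"
    unfolding ray_average_def
  proof (rule integral_bound)
    show "continuous_on {0..1} (\<lambda>\<tau>. \<tau> ^ i *\<^sub>R \<phi> i (\<tau> * x))"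
      by (intro continuous_intros
          continuous_on_compose2[OF is_jet_continuous_on[OF assms(1), of UNIV]]) auto
    fix \<tau> :: real assume \<tau>: "\<tau> \<in> {0..1}"
    then have "\<tau> * x \<le> 1 * x" using x by (intro mult_right_mono) auto
    then have "norm (\<phi> i (\<tau> * x)) \<le> M" using \<tau> x by (intro M) auto
    moreover have "\<bar>\<tau>\<bar> ^ i \<le> 1" using \<tau> by (simp add: power_le_one)
    ultimately show "norm (\<tau> ^ i *\<^sub>R \<phi> i (\<tau> * x)) \<le> M"
      using mult_mono[of "\<bar>\<tau>\<bar> ^ i" 1 "norm (\<phi> i (\<tau> * x))" M] by (simp add: power_abs)
  qed auto
  then show ?thesis by simp
qed

section \<open>Decay of the coefficients\<close>

text \<open>The factor in parentheses collects the boundary terms and the remaining integral after two integrations by parts;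
\<open>4 * A\<^sup>2\<close> comes from replacing \<open>(k * pi / A)\<^sup>2\<close> by \<open>(k + 1)\<^sup>2\<close>.\<close>

definition decay_constant :: "real \<Rightarrow> real" where
  "decay_constant A = 4 * A\<^sup>2 * (2 + A + 3 * A\<^sup>2 + A ^ 3)"

text \<open>Integrating by parts twice gains a factor of order \<open>1 / k\<^sup>2\<close>. The second step requires a division by \<open>x\<close>, because
\<open>d/dx sqrt (A\<^sup>2 - x\<^sup>2) = - x / sqrt (A\<^sup>2 - x\<^sup>2)\<close>; it is harmless because the derivative of \<open>\<phi> 0\<close> vanishes
at the origin, so that the quotient of the derivative by \<open>x\<close> is smooth and bounded by higher derivatives of \<open>\<phi> 0\<close>. The boundary
terms that would be of first order in \<open>1 / k\<close> vanish: one contains \<open>sqrt (A\<^sup>2 - A\<^sup>2)\<close>, the other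
\<open>sin (k * pi)\<close>. The bound depends on \<open>\<phi>\<close> only through \<open>M\<close>, which permits a second application to functions of a
second variable.\<close>

lemma norm_chord_transform_le:
  assumes A: "A > 0" and \<phi>: "is_jet \<phi>" and zero: "\<phi> 1 0 = 0"
    and M: "\<And>i x. i \<le> 3 \<Longrightarrow> x \<in> {0..A} \<Longrightarrow> norm (\<phi> i x) \<le> M"
  shows "norm (chord_transform A k (\<phi> 0)) \<le> decay_constant A * M / (real k + 1)\<^sup>2"
proof -
  have M0: "M \<ge> 0" using order_trans[OF norm_ge_zero M[of 0 0]] A by auto
  define K where "K = 2 + A + 3 * A\<^sup>2 + A ^ 3"
  have K: "K \<ge> 1" using A by (simp add: K_def)
  have main: "(real k + 1)\<^sup>2 * norm (chord_transform A k (\<phi> 0)) \<le> 4 * A\<^sup>2 * K * M"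
  proof (cases "k = 0")
    case True
    have "norm (chord_transform A k (\<phi> 0)) \<le> (A * M) * (A - 0)"
      unfolding chord_transform_def
    proof (rule integral_bound)
      show "continuous_on {0..A} (\<lambda>x. (x * cos (real k * (pi / A) * sqrt (A\<^sup>2 - x\<^sup>2))) *\<^sub>R \<phi> 0 x)"
        by (intro continuous_intros is_jet_continuous_on[OF \<phi>])
      show "norm ((x * cos (real k * (pi / A) * sqrt (A\<^sup>2 - x\<^sup>2))) *\<^sub>R \<phi> 0 x) \<le> A * M"
        if "x \<in> {0..A}" for x
        using that M[of 0 x] by (auto simp: True intro!: mult_mono)
    qed (use A in auto)
    also have "\<dots> = A\<^sup>2 * 1 * M" by (simp add: power2_eq_square)
    also have "\<dots> \<le> A\<^sup>2 * K * M" using K M0 by (intro mult_mono) auto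
    also have "\<dots> \<le> 4 * (A\<^sup>2 * K * M)" using K M0 by simp
    finally show ?thesis by (simp add: True)
  next
    case False
    define w where "w = real k * (pi / A)"
    have w: "w > 0" using False A by (simp add: w_def)
    define s where "s = (\<lambda>x. sqrt (A\<^sup>2 - x\<^sup>2))"
    \<comment> \<open>\<open>q 0 x\<close> is the derivative of \<open>\<phi> 0\<close> divided by \<open>x\<close>, continued smoothly to \<open>x = 0\<close>.\<close>
    define q where "q = ray_average (\<lambda>i. \<phi> (Suc (Suc i)))"
    have jet': "is_jet (\<lambda>i. \<phi> (Suc i))" using \<phi> by (simp add: is_jet_def)
    have q: "is_jet q" unfolding q_def using \<phi> by (intro is_jet_ray_average) (simp add: is_jet_def)
    have xq: "x *\<^sub>R q 0 x = \<phi> 1 x" for x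
      using hadamard_lemma[OF jet', of x] zero by (simp add: q_def)
    have q_le: "norm (q i x) \<le> M" if "i \<le> 1" "x \<in> {0..A}" for i x
      unfolding q_def using \<phi> that by (intro norm_ray_average_le[of _ A] M) (auto simp: is_jet_def)
    define \<psi> where "\<psi> = (\<lambda>x. (A\<^sup>2 - x\<^sup>2) *\<^sub>R q 0 x - \<phi> 0 x)"
    define \<psi>' where "\<psi>' = (\<lambda>x. (A\<^sup>2 - x\<^sup>2) *\<^sub>R q 1 x + (- 2 * x) *\<^sub>R q 0 x - \<phi> 1 x)"
    have \<psi>: "(\<psi> has_vector_derivative \<psi>' x) (at x)" for x
      unfolding \<psi>_def \<psi>'_def using q \<phi>
      by (intro has_vector_derivative_diff has_vector_derivative_scaleR)
        (auto simp: is_jet_def intro!: derivative_eq_intros)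
    \<comment> \<open>Both integrations by parts at once: the derivative of \<open>F\<close> is the integrand of the transform plus a bounded multiple of \<open>1 / w\<^sup>2\<close>.\<close>
    define F where "F = (\<lambda>x. (- (s x * sin (w * s x)) / w) *\<^sub>R \<phi> 0 x + (cos (w * s x) / w\<^sup>2) *\<^sub>R \<psi> x)"
    define I1 where "I1 = (\<lambda>x. (x * cos (w * s x)) *\<^sub>R \<phi> 0 x)"
    define I2 where "I2 = (\<lambda>x. (cos (w * s x) / w\<^sup>2) *\<^sub>R \<psi>' x)"
    have cont_s: "continuous_on S s" for S unfolding s_def by (intro continuous_intros)
    note cont = is_jet_continuous_on[OF \<phi>] is_jet_continuous_on[OF q] cont_s
    have cont_psi: "continuous_on S \<psi>" "continuous_on S \<psi>'" for S
      unfolding \<psi>_def \<psi>'_def by (intro continuous_intros cont)+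
    have I: "continuous_on {0..A} I1" "continuous_on {0..A} I2"
      unfolding I1_def I2_def using w by (auto intro!: continuous_intros cont cont_psi)
    have "((\<lambda>x. I1 x + I2 x) has_integral F A - F 0) {0..A}"
    proof (rule fundamental_theorem_of_calculus_interior)
      show "continuous_on {0..A} F"
        unfolding F_def using w by (auto intro!: continuous_intros cont cont_psi)
      fix x assume x: "x \<in> {0<..<A}"
      then have "x\<^sup>2 < A\<^sup>2" by (intro power_strict_mono) auto
      then have sx: "s x > 0" and ss: "A\<^sup>2 - x\<^sup>2 = s x * s x"
        by (auto simp: s_def)
      have ds: "(s has_real_derivative - x / s x) (at x)"
        unfolding s_def using sqrt_diff_squares_DERIV[of x A UNIV] x by simp
      have d1: "((\<lambda>x. - (s x * sin (w * s x)) / w) has_real_derivative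
          (x * sin (w * s x) / (w * s x) + x * cos (w * s x))) (at x)"
        by (rule derivative_eq_intros ds refl)+ (use sx w in \<open>simp_all add: field_simps\<close>)
      have d2: "((\<lambda>x. cos (w * s x) / w\<^sup>2) has_real_derivative (x * sin (w * s x) / (w * s x))) (at x)"
        by (rule derivative_eq_intros ds refl)+ (use sx w in \<open>simp_all add: field_simps power2_eq_square\<close>)
      have "(F has_vector_derivative
          (- (s x * sin (w * s x)) / w) *\<^sub>R \<phi> (Suc 0) x + (x * sin (w * s x) / (w * s x) + x * cos (w * s x)) *\<^sub>R \<phi> 0 x +
          ((cos (w * s x) / w\<^sup>2) *\<^sub>R \<psi>' x + (x * sin (w * s x) / (w * s x)) *\<^sub>R \<psi> x)) (at x)"
        unfolding F_def using \<phi>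
        by (intro has_vector_derivative_add has_vector_derivative_scaleR d1 d2 \<psi>) (auto simp: is_jet_def)
      also have "(x * sin (w * s x) / (w * s x)) *\<^sub>R \<psi> x =
          (s x * sin (w * s x) / w) *\<^sub>R (x *\<^sub>R q 0 x) - (x * sin (w * s x) / (w * s x)) *\<^sub>R \<phi> 0 x"
        unfolding \<psi>_def ss using sx w by (simp add: scaleR_diff_right)
      finally show "(F has_vector_derivative I1 x + I2 x) (at x)"
        unfolding xq I1_def I2_def by (simp add: scaleR_add_left)
    qed (use A in auto)
    moreover have "((\<lambda>x. I1 x + I2 x) has_integral integral {0..A} I1 + integral {0..A} I2) {0..A}"
      by (intro has_integral_add integrable_integral integrable_continuous_interval I)
    ultimately have "F A - F 0 = integral {0..A} I1 + integral {0..A} I2"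
      by (rule has_integral_unique)
    then have "integral {0..A} I1 = F A - F 0 - integral {0..A} I2"
      by simp
    moreover have "chord_transform A k (\<phi> 0) = integral {0..A} I1"
      by (simp add: chord_transform_def I1_def w_def s_def)
    ultimately have ct: "norm (chord_transform A k (\<phi> 0)) \<le> norm (F A) + norm (F 0) + norm (integral {0..A} I2)"
      using norm_triangle_ineq4[of "F A - F 0" "integral {0..A} I2"] norm_triangle_ineq4[of "F A" "F 0"]
      by simp
    have "s A = 0" "s 0 = A" using A by (auto simp: s_def)
    moreover have "sin (w * A) = 0"
      using A by (simp add: w_def)
    ultimately have "norm (F A) = norm (\<phi> 0 A) / w\<^sup>2"
      and F0: "norm (F 0) = \<bar>cos (w * A)\<bar> * norm (\<psi> 0) / w\<^sup>2"
      by (auto simp: F_def \<psi>_def)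
    then have FA_le: "norm (F A) \<le> M / w\<^sup>2"
      using M[of 0 A] A by (auto intro!: divide_right_mono)
    have cos_mult: "\<bar>cos t\<bar> * y \<le> y" if "y \<ge> 0" for t y :: real
      using mult_right_mono[of "\<bar>cos t\<bar>" 1 y] that by simp
    have "norm (\<psi> 0) \<le> A\<^sup>2 * norm (q 0 0) + norm (\<phi> 0 0)"
      unfolding \<psi>_def by (rule order_trans[OF norm_triangle_ineq4]) simp
    also have "\<dots> \<le> A\<^sup>2 * M + M"
      using q_le[of 0 0] M[of 0 0] A by (intro add_mono mult_left_mono) auto
    finally have "norm (F 0) \<le> (A\<^sup>2 * M + M) / w\<^sup>2"
      unfolding F0 using cos_mult[of "norm (\<psi> 0)"] by (intro divide_right_mono) (auto intro: order_trans)
    moreover have "norm (integral {0..A} I2) \<le> (A\<^sup>2 * M + 2 * A * M + M) / w\<^sup>2 * (A - 0)"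
    proof (rule integral_bound)
      fix x assume x: "x \<in> {0..A}"
      have "x\<^sup>2 \<le> A\<^sup>2" using x by (intro power_mono) auto
      then have "norm (\<psi>' x) \<le> A\<^sup>2 * M + 2 * A * M + M"
        unfolding \<psi>'_def
        using x q_le[of 0 x] q_le[of 1 x] M[of 1 x] M0 A
        by (intro order_trans[OF norm_triangle_ineq4] order_trans[OF norm_triangle_ineq] add_mono)
          (auto intro!: mult_mono)
      then show "norm (I2 x) \<le> (A\<^sup>2 * M + 2 * A * M + M) / w\<^sup>2"
        unfolding I2_def using cos_mult[of "norm (\<psi>' x)" "w * s x"]
        by (auto intro!: divide_right_mono intro: order_trans)
    qed (use A I in auto)
    ultimately have "norm (chord_transform A k (\<phi> 0)) \<le>
        M / w\<^sup>2 + (A\<^sup>2 * M + M) / w\<^sup>2 + (A\<^sup>2 * M + 2 * A * M + M) / w\<^sup>2 * (A - 0)"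
      using ct FA_le by linarith
    also have "\<dots> = K * M / w\<^sup>2"
      using w by (simp add: K_def divide_simps) (simp add: algebra_simps power2_eq_square power3_eq_cube)
    finally have ct_le: "norm (chord_transform A k (\<phi> 0)) \<le> K * M / w\<^sup>2" .
    \<comment> \<open>Passing from \<open>w = k * pi / A\<close> to \<open>k + 1\<close>, which also makes sense at \<open>k = 0\<close>, costs the factor \<open>4 * A\<^sup>2\<close>.\<close>
    have "real k + 1 \<le> 2 * real k" using False by simp
    also have "\<dots> \<le> 2 * (w * A)"
    proof -
      have "w * A = real k * pi" using A by (simp add: w_def)
      moreover have "real k * 1 \<le> real k * pi" using pi_ge_two by (intro mult_left_mono) auto
      ultimately show ?thesis by simp
    qed
    finally have "(real k + 1)\<^sup>2 \<le> (2 * (w * A))\<^sup>2" by (intro power_mono) auto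
    then have "(real k + 1)\<^sup>2 * norm (chord_transform A k (\<phi> 0)) \<le> (2 * (w * A))\<^sup>2 * (K * M / w\<^sup>2)"
      using ct_le by (intro mult_mono) auto
    also have "\<dots> = 4 * A\<^sup>2 * K * M" using w by (simp add: power_mult_distrib)
    finally show ?thesis .
  qed
  then show ?thesis
    by (simp add: decay_constant_def K_def[symmetric] pos_le_divide_eq mult.commute)
qed

section \<open>Smooth functions of two variables and their double series\<close>

text \<open>Here \<open>\<Phi> i j\<close> stands for the derivative taken \<open>j\<close> times in \<open>r\<close> and then \<open>i\<close> times in \<open>x\<close>. With this order a
derivative in \<open>r\<close> is only ever taken before those in \<open>x\<close>, which is why differentiability in \<open>r\<close> is asked of the row
\<open>i = 0\<close> alone.\<close>

definition is_jet2 :: "(nat \<Rightarrow> nat \<Rightarrow> real \<Rightarrow> real \<Rightarrow> complex) \<Rightarrow> bool" where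
  "is_jet2 \<Phi> \<longleftrightarrow>
     (\<forall>i j. continuous_on UNIV (\<lambda>(x, r). \<Phi> i j x r)) \<and>
     (\<forall>j r. is_jet (\<lambda>i x. \<Phi> i j x r)) \<and>
     (\<forall>x. is_jet (\<lambda>j r. \<Phi> 0 j x r))"

lemma is_jet2_continuous_on_compose:
  assumes "is_jet2 \<Phi>" "continuous_on S u" "continuous_on S v"
  shows "continuous_on S (\<lambda>p. \<Phi> i j (u p) (v p))"
proof -
  have "continuous_on UNIV (\<lambda>(x, r). \<Phi> i j x r)"
    using assms(1) by (simp add: is_jet2_def)
  then have "continuous_on S (\<lambda>p. (\<lambda>(x, r). \<Phi> i j x r) (u p, v p))"
    by (rule continuous_on_compose2) (auto intro: continuous_intros assms)
  then show ?thesis by simp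
qed

lemma is_jet2_bounded_on_rectangle:
  assumes "is_jet2 \<Phi>"
  obtains M where "\<And>i j x r. i \<le> n \<Longrightarrow> j \<le> n \<Longrightarrow> x \<in> {0..L} \<Longrightarrow> r \<in> {0..R} \<Longrightarrow> norm (\<Phi> i j x r) \<le> M"
proof -
  have "bounded ((\<lambda>(x, r). \<Phi> i j x r) ` ({0..L} \<times> {0..R}))" for i j
    unfolding case_prod_unfold
    by (intro compact_imp_bounded compact_continuous_image is_jet2_continuous_on_compose[OF assms]
        compact_Times compact_Icc continuous_intros)
  then have "bounded (\<Union>i\<in>{..n}. \<Union>j\<in>{..n}. (\<lambda>(x, r). \<Phi> i j x r) ` ({0..L} \<times> {0..R}))"
    by (intro bounded_UN) auto
  then obtain M where M: "\<forall>z\<in>(\<Union>i\<in>{..n}. \<Union>j\<in>{..n}. (\<lambda>(x, r). \<Phi> i j x r) ` ({0..L} \<times> {0..R})). norm z \<le> M"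
    unfolding bounded_iff by blast
  show thesis
  proof (rule that)
    fix i j x r
    assume "i \<le> n" "j \<le> n" "x \<in> {0..L}" "r \<in> {0..R}"
    then have "\<Phi> i j x r \<in> (\<Union>i\<in>{..n}. \<Union>j\<in>{..n}. (\<lambda>(x, r). \<Phi> i j x r) ` ({0..L} \<times> {0..R}))"
      by force
    then show "norm (\<Phi> i j x r) \<le> M" using M by blast
  qed
qed

lemma is_jet_chord_transform:
  assumes "is_jet2 \<Phi>"
  shows "is_jet (\<lambda>j r. chord_transform L k (\<lambda>x. \<Phi> 0 j x r))"
  unfolding is_jet_def
proof (intro allI)
  fix j r
  define w where "w = (\<lambda>x. x * cos (real k * (pi / L) * sqrt (L\<^sup>2 - x\<^sup>2)))"
  have w: "continuous_on S (\<lambda>p. w (v p))" if "continuous_on S v" for S and v :: "'a::topological_space \<Rightarrow> real"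
  proof (rule continuous_on_compose2[OF _ that])
    show "continuous_on UNIV w" unfolding w_def by (intro continuous_intros)
  qed simp
  have "((\<lambda>r. integral (cbox 0 L) (\<lambda>x. w x *\<^sub>R \<Phi> 0 j x r)) has_vector_derivative
      integral (cbox 0 L) (\<lambda>x. w x *\<^sub>R \<Phi> 0 (Suc j) x r)) (at r within UNIV)"
  proof (rule leibniz_rule_vector_derivative)
    show "((\<lambda>r. w x *\<^sub>R \<Phi> 0 j x r) has_vector_derivative w x *\<^sub>R \<Phi> 0 (Suc j) x y) (at y within UNIV)" for x y
      using assms by (intro bounded_linear.has_vector_derivative[OF bounded_linear_scaleR_right])
        (auto simp: is_jet2_def is_jet_def)
    show "(\<lambda>x. w x *\<^sub>R \<Phi> 0 j x y) integrable_on cbox 0 L" for y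
      by (intro integrable_continuous continuous_intros w is_jet2_continuous_on_compose[OF assms])
    show "continuous_on (UNIV \<times> cbox 0 L) (\<lambda>(r, x). w x *\<^sub>R \<Phi> 0 (Suc j) x r)"
      unfolding case_prod_unfold
      by (intro continuous_intros w is_jet2_continuous_on_compose[OF assms])
  qed auto
  then show "((\<lambda>r. chord_transform L k (\<lambda>x. \<Phi> 0 j x r)) has_vector_derivative
      chord_transform L k (\<lambda>x. \<Phi> 0 (Suc j) x r)) (at r)"
    by (simp add: chord_transform_def w_def)
qed

lemma summable_inverse_square_Suc: "summable (\<lambda>k. 1 / (real k + 1)\<^sup>2)"
  using summable_Suc_iff[of "\<lambda>k. inverse (real k ^ 2)"] inverse_power_summable[of 2, where 'a = real]
  by (simp add: inverse_eq_divide add.commute)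

lemma abs_summable_on_product_bound:
  fixes F :: "nat \<times> nat \<Rightarrow> complex"
  assumes "summable w" and w: "\<And>k. w k \<ge> 0"
    and F: "\<And>k l. norm (F (k, l)) \<le> C * (w k * w l)" and C: "C \<ge> 0"
  shows "F summable_on UNIV"
proof -
  have w_sum: "w summable_on UNIV"
    using assms(1) w by (intro norm_summable_imp_summable_on) simp
  have "(\<lambda>(k, l). C * (w k * w l)) summable_on (SIGMA k:UNIV. UNIV)"
  proof (rule summable_on_SigmaI)
    show "((\<lambda>l. case (k, l) of (k, l) \<Rightarrow> C * (w k * w l)) has_sum C * (w k * infsum w UNIV)) UNIV" for k
      using w_sum by (auto intro!: has_sum_cmult_right)
    show "(\<lambda>k. C * (w k * infsum w UNIV)) summable_on UNIV"
      using w_sum by (intro summable_on_cmult_right summable_on_cmult_left)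
  qed (use w C in auto)
  then have "(\<lambda>(k, l). C * (w k * w l)) summable_on UNIV" by simp
  then have "(\<lambda>p. norm (F p)) summable_on UNIV"
    by (rule Infinite_Sum.abs_summable_on_comparison_test') (use F in auto)
  then show ?thesis by (rule abs_summable_summable)
qed

text \<open>The factor of \<^const>\<open>i_even\<close> in one variable, with the normalization of the cosine series included.\<close>

definition chord_kernel :: "real \<Rightarrow> nat \<Rightarrow> real \<Rightarrow> real" where
  "chord_kernel A k x =
     neumann_number k / A * (cos (real k * (pi / A) * sqrt (A\<^sup>2 - x\<^sup>2)) / sqrt (A\<^sup>2 - x\<^sup>2))"

lemma abs_chord_kernel_le:
  assumes "A > 0" "0 \<le> x" "x < A"
  shows "\<bar>chord_kernel A k x\<bar> \<le> 2 / A * (1 / sqrt (A\<^sup>2 - x\<^sup>2))"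
proof -
  have "x\<^sup>2 < A\<^sup>2" using assms by (intro power_strict_mono) auto
  then have "\<bar>chord_kernel A k x\<bar> =
      neumann_number k / A * (\<bar>cos (real k * (pi / A) * sqrt (A\<^sup>2 - x\<^sup>2))\<bar> / sqrt (A\<^sup>2 - x\<^sup>2))"
    using neumann_number_pos[of k] assms by (simp add: chord_kernel_def abs_mult)
  also have "\<dots> \<le> 2 / A * (1 / sqrt (A\<^sup>2 - x\<^sup>2))"
    using neumann_number_le_2[of k] assms \<open>x\<^sup>2 < A\<^sup>2\<close>
    by (intro mult_mono divide_right_mono) auto
  finally show ?thesis .
qed

text \<open>The transform in \<open>x\<close> of the derivatives in \<open>r\<close> gives, for each \<open>k\<close>, a smooth function of \<open>r\<close> whose
derivatives all carry the factor \<open>1 / (k + 1)\<^sup>2\<close>. The decay estimate in \<open>r\<close> multiplies this by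
\<open>1 / (l + 1)\<^sup>2\<close>, so the double family is absolutely summable, and its sum can be computed as an iterated sum by applying
the expansion in one variable twice.\<close>

theorem chord_double_series_has_sum:
  assumes L: "L > 0" and R: "R > 0" and \<Phi>: "is_jet2 \<Phi>"
    and zero_x: "\<And>j r. \<Phi> 1 j 0 r = 0" and zero_r: "\<And>x. \<Phi> 0 1 x 0 = 0"
    and x: "0 < x" "x < L" and r: "0 < r" "r < R"
  shows "((\<lambda>(k, l). (chord_kernel L k x * chord_kernel R l r) *\<^sub>R
      chord_transform R l (\<lambda>r. chord_transform L k (\<lambda>x. \<Phi> 0 0 x r))) has_sum \<Phi> 0 0 x r) UNIV"
proof -
  define a where "a = (\<lambda>k j r. chord_transform L k (\<lambda>x. \<Phi> 0 j x r))"
  define c where "c = (\<lambda>k l. chord_transform R l (a k 0))"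
  define w :: "nat \<Rightarrow> real" where "w k = 1 / (real k + 1)\<^sup>2" for k
  have w: "summable w" "\<And>k. w k \<ge> 0"
    using summable_inverse_square_Suc by (simp_all add: w_def[abs_def])
  obtain M where M: "\<And>i j x r. i \<le> 3 \<Longrightarrow> j \<le> 3 \<Longrightarrow> x \<in> {0..L} \<Longrightarrow> r \<in> {0..R} \<Longrightarrow> norm (\<Phi> i j x r) \<le> M"
    using is_jet2_bounded_on_rectangle[OF \<Phi>] by metis
  have jet_x: "is_jet (\<lambda>i x. \<Phi> i j x r)" for j r
    using \<Phi> by (simp add: is_jet2_def)
  have jet_r: "is_jet (a k)" for k
    unfolding a_def by (rule is_jet_chord_transform[OF \<Phi>])
  have a_le: "norm (a k j r) \<le> decay_constant L * M * w k" if "j \<le> 3" "r \<in> {0..R}" for k j r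
    using norm_chord_transform_le[OF L jet_x zero_x M[OF _ that(1) _ that(2)], of k]
    by (simp add: a_def w_def)
  have "a k 1 0 = 0" for k by (simp add: a_def zero_r[simplified] chord_transform_def)
  then have c_le': "norm (c k l) \<le> decay_constant R * (decay_constant L * M * w k) * w l" for k l
    using norm_chord_transform_le[OF R jet_r[of k], of "decay_constant L * M * w k" l] a_le[of _ _ k]
    by (simp only: c_def w_def[of l] mult_1_right times_divide_eq_right)
  define D where "D = decay_constant R * (decay_constant L * M)"
  have c_le: "norm (c k l) \<le> D * (w k * w l)" for k l
    using c_le'[of k l] by (simp add: D_def mult_ac)
  have D: "D \<ge> 0"
    using order_trans[OF norm_ge_zero c_le[of 0 0]] by (simp add: w_def)
  define F where "F = (\<lambda>(k, l). (chord_kernel L k x * chord_kernel R l r) *\<^sub>R c k l)"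
  define E where "E = (2 / L * (1 / sqrt (L\<^sup>2 - x\<^sup>2))) * (2 / R * (1 / sqrt (R\<^sup>2 - r\<^sup>2)))"
  have kernel_le: "\<bar>chord_kernel L k x * chord_kernel R l r\<bar> \<le> E" for k l
    unfolding E_def abs_mult
    using abs_chord_kernel_le[of L x k] abs_chord_kernel_le[of R r l] L R x r
    by (intro mult_mono) (auto intro: order_trans[OF abs_ge_zero])
  have E: "E \<ge> 0" using order_trans[OF abs_ge_zero kernel_le] .
  have summable_F: "F summable_on UNIV"
  proof (rule abs_summable_on_product_bound[OF w])
    fix k l
    have "norm (F (k, l)) = \<bar>chord_kernel L k x * chord_kernel R l r\<bar> * norm (c k l)"
      by (simp add: F_def)
    also have "\<dots> \<le> E * (D * (w k * w l))"
      using kernel_le c_le E by (intro mult_mono) auto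
    finally show "norm (F (k, l)) \<le> (E * D) * (w k * w l)" by simp
  qed (use D E in simp)
  have inner: "((\<lambda>l. F (k, l)) has_sum chord_kernel L k x *\<^sub>R a k 0 r) UNIV" for k
  proof -
    have "summable (\<lambda>l. norm (chord_transform R l (a k 0)))"
    proof (rule summable_comparison_test'[OF summable_mult[OF w(1), of "D * w k"]])
      show "norm (norm (chord_transform R l (a k 0))) \<le> D * w k * w l" for l
        using c_le[of k l] by (simp add: c_def mult.assoc)
    qed
    from chord_series_has_sum[OF R is_jet_continuous_on[OF jet_r] this r]
    have "((\<lambda>l. chord_kernel R l r *\<^sub>R c k l) has_sum a k 0 r) UNIV"
      by (simp only: chord_kernel_def c_def)
    from has_sum_scaleR[OF this, of "chord_kernel L k x"] show ?thesis by (simp add: F_def)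
  qed
  have outer: "((\<lambda>k. chord_kernel L k x *\<^sub>R a k 0 r) has_sum \<Phi> 0 0 x r) UNIV"
  proof -
    have "summable (\<lambda>k. norm (chord_transform L k (\<lambda>x. \<Phi> 0 0 x r)))"
    proof (rule summable_comparison_test'[OF summable_mult[OF w(1), of "decay_constant L * M"]])
      show "norm (norm (chord_transform L k (\<lambda>x. \<Phi> 0 0 x r))) \<le> decay_constant L * M * w k" for k
        using a_le[of 0 r k] r by (simp add: a_def)
    qed
    from chord_series_has_sum[OF L is_jet_continuous_on[OF jet_x, of _ 0 0 r] this x]
    show ?thesis by (simp only: chord_kernel_def a_def)
  qed
  have "(F has_sum \<Phi> 0 0 x r) (SIGMA k:UNIV. UNIV)"
    by (rule has_sum_SigmaI[OF inner outer]) (use summable_F in simp)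
  then show ?thesis by (simp add: F_def c_def a_def)
qed

section \<open>Parity and ray averages\<close>

lemma is_jet_determined_by_function:
  assumes "is_jet \<phi>" "is_jet \<psi>" "\<And>x. \<phi> 0 x = \<psi> 0 x"
  shows "\<phi> i x = \<psi> i x"
proof (induction i arbitrary: x)
  case (Suc i)
  then have "\<phi> i = \<psi> i" by auto
  then show ?case
    using assms(1,2) vector_derivative_unique_at unfolding is_jet_def by metis
qed (use assms in simp)

lemma has_vector_derivative_reflect:
  fixes h :: "real \<Rightarrow> complex"
  assumes "(h has_vector_derivative d) (at (- x))"
  shows "((\<lambda>x. h (- x)) has_vector_derivative - d) (at x)"
proof -
  have "(uminus has_vector_derivative (- 1 :: real)) (at x)"
    by (auto intro!: derivative_eq_intros)
  from vector_diff_chain_at[OF this] assms show ?thesis by (simp add: o_def)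
qed

lemma is_jet_even_imp_deriv_odd:
  assumes "is_jet \<phi>" "\<And>x. \<phi> 0 (- x) = \<phi> 0 x"
  shows "\<phi> 1 (- x) = - \<phi> 1 x"
proof -
  have "((\<lambda>x. \<phi> 0 (- x)) has_vector_derivative - \<phi> 1 (- x)) (at x)"
    using assms(1) by (intro has_vector_derivative_reflect) (auto simp: is_jet_def)
  moreover have "(\<phi> 0 has_vector_derivative \<phi> 1 x) (at x)"
    using assms(1) by (simp add: is_jet_def)
  ultimately show ?thesis
    using assms(2) vector_derivative_unique_at by (metis (no_types, lifting) ext minus_minus)
qed

lemma is_jet_odd_imp_deriv_even:
  assumes "is_jet \<phi>" "\<And>x. \<phi> 0 (- x) = - \<phi> 0 x"
  shows "\<phi> 1 (- x) = \<phi> 1 x"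
proof -
  have "((\<lambda>x. - \<phi> 0 (- x)) has_vector_derivative - (- \<phi> 1 (- x))) (at x)"
    using assms(1) by (intro has_vector_derivative_minus has_vector_derivative_reflect) (auto simp: is_jet_def)
  moreover have "(\<phi> 0 has_vector_derivative \<phi> 1 x) (at x)"
    using assms(1) by (simp add: is_jet_def)
  ultimately show ?thesis
    using assms(2) vector_derivative_unique_at by (metis (no_types, lifting) ext minus_minus)
qed

text \<open>Differentiating in \<open>r\<close> preserves evenness in \<open>x\<close>, and the derivative in \<open>x\<close> of an even function is odd.\<close>

lemma is_jet2_even_imp_deriv_zero:
  assumes \<Phi>: "is_jet2 \<Phi>" and even: "\<And>x r. \<Phi> 0 0 (- x) r = \<Phi> 0 0 x r"
  shows "\<Phi> 1 j 0 r = 0"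
proof -
  have "\<Phi> 0 j (- x) r = \<Phi> 0 j x r" for x
    using is_jet_determined_by_function[of "\<lambda>j. \<Phi> 0 j (- x)" "\<lambda>j. \<Phi> 0 j x" j r] \<Phi> even by (simp add: is_jet2_def)
  then have "\<Phi> 1 j (- 0) r = - \<Phi> 1 j 0 r"
    using is_jet_even_imp_deriv_odd[of "\<lambda>i x. \<Phi> i j x r" 0] \<Phi> by (simp add: is_jet2_def)
  then show ?thesis by simp
qed

lemma is_jet2_ray_average:
  assumes \<Phi>: "is_jet2 \<Phi>"
  shows "is_jet2 (\<lambda>i j x r. ray_average (\<lambda>i x. \<Phi> i j x r) i x)"
  unfolding is_jet2_def
proof (intro conjI allI)
  note cont = is_jet2_continuous_on_compose[OF \<Phi>]
  show "continuous_on UNIV (\<lambda>(x, r). ray_average (\<lambda>i x. \<Phi> i j x r) i x)" for i j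
  proof -
    have "continuous_on UNIV (\<lambda>p. integral (cbox 0 1) (\<lambda>\<tau>. \<tau> ^ i *\<^sub>R \<Phi> i j (\<tau> * fst p) (snd p)))"
      unfolding case_prod_unfold
      by (intro integral_continuous_on_param) (auto simp: case_prod_unfold intro!: continuous_intros cont)
    then show ?thesis by (simp add: ray_average_def case_prod_unfold)
  qed
  show "is_jet (\<lambda>i x. ray_average (\<lambda>i x. \<Phi> i j x r) i x)" for j r
    using is_jet_ray_average[of "\<lambda>i x. \<Phi> i j x r"] \<Phi> by (simp add: is_jet2_def)
  show "is_jet (\<lambda>j r. ray_average (\<lambda>i x. \<Phi> i j x r) 0 x)" for x
    unfolding is_jet_def
  proof (intro allI)
    fix j r
    have "((\<lambda>r. integral (cbox 0 1) (\<lambda>\<tau>. \<Phi> 0 j (\<tau> * x) r)) has_vector_derivative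
        integral (cbox 0 1) (\<lambda>\<tau>. \<Phi> 0 (Suc j) (\<tau> * x) r)) (at r within UNIV)"
    proof (rule leibniz_rule_vector_derivative)
      show "((\<lambda>r. \<Phi> 0 j (\<tau> * x) r) has_vector_derivative \<Phi> 0 (Suc j) (\<tau> * x) y) (at y within UNIV)" for \<tau> y
        using \<Phi> by (simp add: is_jet2_def is_jet_def)
      show "(\<lambda>\<tau>. \<Phi> 0 j (\<tau> * x) y) integrable_on cbox 0 1" for y
        by (intro integrable_continuous continuous_intros cont)
      show "continuous_on (UNIV \<times> cbox 0 1) (\<lambda>(r, \<tau>). \<Phi> 0 (Suc j) (\<tau> * x) r)"
        unfolding case_prod_unfold by (intro continuous_intros cont)
    qed auto
    then show "((\<lambda>r. ray_average (\<lambda>i x. \<Phi> i j x r) 0 x) has_vector_derivative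
        ray_average (\<lambda>i x. \<Phi> i (Suc j) x r) 0 x) (at r)"
      by (simp add: ray_average_def)
  qed
qed

section \<open>Smoothness of circular means\<close>

text \<open>This class is closed under partial differentiation, so circular means of \<open>f\<close> and of its \<open>x\<close>-derivative can be treated alike.\<close>

definition has_all_partials :: "(real \<times> real \<Rightarrow> complex) \<Rightarrow> bool" where
  "has_all_partials f \<longleftrightarrow>
     (\<forall>vs. set vs \<subseteq> Basis \<longrightarrow> (\<forall>p. foldr partial_deriv vs f differentiable (at p)))"

lemma schwartz_space_has_all_partials: "f \<in> schwartz_space \<Longrightarrow> has_all_partials f"
  by (simp add: schwartz_space_def has_all_partials_def)

lemma unit_vectors_in_Basis: "(1 :: real, 0 :: real) \<in> Basis" "(0 :: real, 1 :: real) \<in> Basis"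
  by (auto simp: Basis_prod_def)

lemma has_all_partials_partial_deriv:
  assumes "has_all_partials f" "b \<in> Basis"
  shows "has_all_partials (partial_deriv b f)"
  unfolding has_all_partials_def
proof (intro allI impI)
  fix vs :: "(real \<times> real) list" and p assume "set vs \<subseteq> Basis"
  then have "foldr partial_deriv (vs @ [b]) f differentiable (at p)"
    using assms unfolding has_all_partials_def by (metis Un_subset_iff empty_subsetI insert_subset list.set set_append)
  then show "foldr partial_deriv vs (partial_deriv b f) differentiable (at p)" by simp
qed

lemma has_vector_derivative_along_curve:
  fixes F :: "real \<times> real \<Rightarrow> complex"
  assumes "F differentiable (at (u t, v t))"
    and "(u has_real_derivative a) (at t)" "(v has_real_derivative b) (at t)"
  shows "((\<lambda>t. F (u t, v t)) has_vector_derivative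
    a *\<^sub>R partial_deriv (1, 0) F (u t, v t) + b *\<^sub>R partial_deriv (0, 1) F (u t, v t)) (at t)"
proof -
  define D where "D = frechet_derivative F (at (u t, v t))"
  have D: "(F has_derivative D) (at (u t, v t))"
    unfolding D_def using assms(1) by (simp add: frechet_derivative_works)
  then have lin: "linear D" by (rule has_derivative_linear)
  have "(*) a = (\<lambda>h. h * a)" "(*) b = (\<lambda>h. h * b)" by (simp_all add: fun_eq_iff)
  then have uv: "((\<lambda>t. (u t, v t)) has_derivative (\<lambda>h. (h * a, h * b))) (at t)"
    using assms(2,3) unfolding has_field_derivative_def by (intro has_derivative_Pair) simp_all
  have "D (h * a, h * b) = h *\<^sub>R (a *\<^sub>R D (1, 0) + b *\<^sub>R D (0, 1))" for h
  proof -
    have "(h * a, h * b) = (h * a) *\<^sub>R (1, 0) + (h * b) *\<^sub>R (0 :: real, 1 :: real)" by simp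
    then have "D (h * a, h * b) = (h * a) *\<^sub>R D (1, 0) + (h * b) *\<^sub>R D (0, 1)"
      using lin by (simp only: linear_add linear_scale)
    then show ?thesis by (simp add: scaleR_add_right)
  qed
  then show ?thesis
    using has_derivative_compose[OF uv D]
    by (simp add: has_vector_derivative_def partial_deriv_def D_def[symmetric])
qed

text \<open>The operator \<open>\<partial>\<^sub>x ^ i\<close> applied after \<open>(cos \<theta> \<partial>\<^sub>x + sin \<theta> \<partial>\<^sub>y) ^ j\<close> applied after the iterated partial derivative
\<open>vs\<close>, multiplied out into partial derivatives along basis vectors. These are the derivatives of
\<open>f (x + r * cos \<theta>, r * sin \<theta>)\<close>, \<open>j\<close> times in \<open>r\<close> and then \<open>i\<close> times in \<open>x\<close>. The operators
\<open>\<partial>\<^sub>x\<close> are outermost, as in the order of differentiation of \<^const>\<open>is_jet2\<close>.\<close>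

primrec radial_deriv :: "(real \<times> real \<Rightarrow> complex) \<Rightarrow> real \<Rightarrow> nat \<Rightarrow> nat \<Rightarrow> (real \<times> real) list \<Rightarrow>
    real \<times> real \<Rightarrow> complex" where
  "radial_deriv f \<theta> i 0 vs p = foldr partial_deriv (replicate i (1, 0) @ vs) f p"
| "radial_deriv f \<theta> i (Suc j) vs p =
     cos \<theta> *\<^sub>R radial_deriv f \<theta> i j ((1, 0) # vs) p + sin \<theta> *\<^sub>R radial_deriv f \<theta> i j ((0, 1) # vs) p"

lemma continuous_on_radial_deriv:
  fixes t u v :: "'a :: t2_space \<Rightarrow> real"
  assumes f: "has_all_partials f" and vs: "set vs \<subseteq> Basis"
    and "continuous_on S t" "continuous_on S u" "continuous_on S v"
  shows "continuous_on S (\<lambda>p. radial_deriv f (t p) i j vs (u p, v p))"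
  using vs
proof (induction j arbitrary: vs)
  case 0
  have "set (replicate i (1, 0) @ vs) \<subseteq> Basis" using 0 unit_vectors_in_Basis by auto
  then have "foldr partial_deriv (replicate i (1, 0) @ vs) f differentiable (at p)" for p
    using f unfolding has_all_partials_def by blast
  then have "continuous_on UNIV (foldr partial_deriv (replicate i (1, 0) @ vs) f)"
    by (intro continuous_at_imp_continuous_on ballI differentiable_imp_continuous_within) auto
  then show ?case
    unfolding radial_deriv.simps
    by (rule continuous_on_compose2) (auto intro!: continuous_intros assms)
next
  case (Suc j)
  then show ?case
    unfolding radial_deriv.simps
    by (intro continuous_intros assms Suc.IH) (use unit_vectors_in_Basis in auto)
qed

lemma radial_deriv_has_derivative_x:
  assumes f: "has_all_partials f" and vs: "set vs \<subseteq> Basis"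
  shows "((\<lambda>x. radial_deriv f \<theta> i j vs (x + a, b)) has_vector_derivative
    radial_deriv f \<theta> (Suc i) j vs (x + a, b)) (at x)"
  using vs
proof (induction j arbitrary: vs)
  case 0
  have "set (replicate i (1, 0) @ vs) \<subseteq> Basis" using 0 unit_vectors_in_Basis by auto
  then have "foldr partial_deriv (replicate i (1, 0) @ vs) f differentiable (at (x + a, b))"
    using f unfolding has_all_partials_def by blast
  moreover have "((\<lambda>x. x + a) has_real_derivative 1) (at x)"
    by (auto intro!: derivative_eq_intros)
  ultimately show ?case
    using has_vector_derivative_along_curve[of _ "\<lambda>x. x + a" x "\<lambda>_. b" 1 0] by simp
next
  case (Suc j)
  show ?case
    unfolding radial_deriv.simps
    by (intro has_vector_derivative_add bounded_linear.has_vector_derivative[OF bounded_linear_scaleR_right] Suc.IH)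
      (use Suc.prems unit_vectors_in_Basis in auto)
qed

lemma radial_deriv_has_derivative_r:
  assumes f: "has_all_partials f" and vs: "set vs \<subseteq> Basis"
  shows "((\<lambda>r. radial_deriv f \<theta> 0 j vs (x + r * cos \<theta>, r * sin \<theta>)) has_vector_derivative
    radial_deriv f \<theta> 0 (Suc j) vs (x + r * cos \<theta>, r * sin \<theta>)) (at r)"
  using vs
proof (induction j arbitrary: vs)
  case 0
  then have "foldr partial_deriv vs f differentiable (at (x + r * cos \<theta>, r * sin \<theta>))"
    using f unfolding has_all_partials_def by blast
  moreover have "((\<lambda>r. x + r * cos \<theta>) has_real_derivative cos \<theta>) (at r)"
      "((\<lambda>r. r * sin \<theta>) has_real_derivative sin \<theta>) (at r)"
    by (auto intro!: derivative_eq_intros)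
  ultimately show ?case
    using has_vector_derivative_along_curve[of _ "\<lambda>r. x + r * cos \<theta>" r "\<lambda>r. r * sin \<theta>" "cos \<theta>" "sin \<theta>"]
    by simp
next
  case (Suc j)
  have "((\<lambda>r. cos \<theta> *\<^sub>R radial_deriv f \<theta> 0 j ((1, 0) # vs) (x + r * cos \<theta>, r * sin \<theta>) +
        sin \<theta> *\<^sub>R radial_deriv f \<theta> 0 j ((0, 1) # vs) (x + r * cos \<theta>, r * sin \<theta>)) has_vector_derivative
      cos \<theta> *\<^sub>R radial_deriv f \<theta> 0 (Suc j) ((1, 0) # vs) (x + r * cos \<theta>, r * sin \<theta>) +
        sin \<theta> *\<^sub>R radial_deriv f \<theta> 0 (Suc j) ((0, 1) # vs) (x + r * cos \<theta>, r * sin \<theta>)) (at r)"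
    by (intro has_vector_derivative_add bounded_linear.has_vector_derivative[OF bounded_linear_scaleR_right] Suc.IH)
      (use Suc.prems unit_vectors_in_Basis in auto)
  then show ?case by simp
qed

definition circle_jet ::
  "(real \<times> real \<Rightarrow> complex) \<Rightarrow> nat \<Rightarrow> nat \<Rightarrow> real \<Rightarrow> real \<Rightarrow> complex" where
  "circle_jet f i j x r = (1 / (2 * pi)) *\<^sub>R
     integral {0..2 * pi} (\<lambda>\<theta>. radial_deriv f \<theta> i j [] (x + r * cos \<theta>, r * sin \<theta>))"

lemma is_jet2_circle_jet:
  assumes f: "has_all_partials f"
  shows "is_jet2 (circle_jet f)"
  unfolding is_jet2_def
proof (intro conjI allI)
  note cont = continuous_on_radial_deriv[OF f, of "[]", simplified]
  show "continuous_on UNIV (\<lambda>(x, r). circle_jet f i j x r)" for i j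
  proof -
    have "continuous_on UNIV (\<lambda>p. integral (cbox 0 (2 * pi))
        (\<lambda>\<theta>. radial_deriv f \<theta> i j [] (fst p + snd p * cos \<theta>, snd p * sin \<theta>)))"
      by (intro integral_continuous_on_param) (auto simp: case_prod_unfold intro!: continuous_intros cont)
    then show ?thesis
      unfolding circle_jet_def case_prod_unfold by (auto intro!: continuous_intros)
  qed
  have int: "(\<lambda>\<theta>. radial_deriv f \<theta> i j [] (x + r * cos \<theta>, r * sin \<theta>)) integrable_on cbox 0 (2 * pi)"
    for i j x r
    by (intro integrable_continuous continuous_intros cont)
  show "is_jet (\<lambda>i x. circle_jet f i j x r)" for j r
    unfolding is_jet_def circle_jet_def
  proof (intro allI bounded_linear.has_vector_derivative[OF bounded_linear_scaleR_right])
    fix i x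
    have "((\<lambda>x. integral (cbox 0 (2 * pi)) (\<lambda>\<theta>. radial_deriv f \<theta> i j [] (x + r * cos \<theta>, r * sin \<theta>)))
      has_vector_derivative integral (cbox 0 (2 * pi))
        (\<lambda>\<theta>. radial_deriv f \<theta> (Suc i) j [] (x + r * cos \<theta>, r * sin \<theta>))) (at x within UNIV)"
      by (intro leibniz_rule_vector_derivative int)
        (auto simp: case_prod_unfold intro!: radial_deriv_has_derivative_x f continuous_intros cont)
    then show "((\<lambda>x. integral {0..2 * pi} (\<lambda>\<theta>. radial_deriv f \<theta> i j [] (x + r * cos \<theta>, r * sin \<theta>)))
      has_vector_derivative integral {0..2 * pi}
        (\<lambda>\<theta>. radial_deriv f \<theta> (Suc i) j [] (x + r * cos \<theta>, r * sin \<theta>))) (at x)"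
      by simp
  qed
  show "is_jet (\<lambda>j r. circle_jet f 0 j x r)" for x
    unfolding is_jet_def circle_jet_def
  proof (intro allI bounded_linear.has_vector_derivative[OF bounded_linear_scaleR_right])
    fix j r
    have "((\<lambda>r. integral (cbox 0 (2 * pi)) (\<lambda>\<theta>. radial_deriv f \<theta> 0 j [] (x + r * cos \<theta>, r * sin \<theta>)))
      has_vector_derivative integral (cbox 0 (2 * pi))
        (\<lambda>\<theta>. radial_deriv f \<theta> 0 (Suc j) [] (x + r * cos \<theta>, r * sin \<theta>))) (at r within UNIV)"
    proof (rule leibniz_rule_vector_derivative)
      show "((\<lambda>r. radial_deriv f \<theta> 0 j [] (x + r * cos \<theta>, r * sin \<theta>)) has_vector_derivative
          radial_deriv f \<theta> 0 (Suc j) [] (x + r * cos \<theta>, r * sin \<theta>)) (at r within UNIV)" for r \<theta>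
        by (rule radial_deriv_has_derivative_r[OF f]) simp
      show "continuous_on (UNIV \<times> cbox 0 (2 * pi))
          (\<lambda>(r, \<theta>). radial_deriv f \<theta> 0 (Suc j) [] (x + r * cos \<theta>, r * sin \<theta>))"
        unfolding case_prod_unfold by (intro cont continuous_intros)
    qed (use int in auto)
    then show "((\<lambda>r. integral {0..2 * pi} (\<lambda>\<theta>. radial_deriv f \<theta> 0 j [] (x + r * cos \<theta>, r * sin \<theta>)))
      has_vector_derivative integral {0..2 * pi}
        (\<lambda>\<theta>. radial_deriv f \<theta> 0 (Suc j) [] (x + r * cos \<theta>, r * sin \<theta>))) (at r)"
      by simp
  qed
qed

lemma circle_jet_partial_deriv: "circle_jet (partial_deriv (1, 0) f) 0 0 = circle_jet f 1 0"
  by (intro ext) (simp add: circle_jet_def)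

text \<open>On the axis \<open>r = 0\<close> the integrand is a linear combination of \<open>cos \<theta>\<close> and \<open>sin \<theta>\<close> with constant coefficients.\<close>

lemma circle_jet_radial_deriv_zero: "circle_jet f 0 1 x 0 = 0"
proof -
  have "((\<lambda>\<theta>. cos \<theta>) has_integral (sin (2 * pi) - sin 0)) {0..2 * pi}"
    and "((\<lambda>\<theta>. sin \<theta>) has_integral (- cos (2 * pi) - - cos 0)) {0..2 * pi}"
    by (rule fundamental_theorem_of_calculus;
        auto intro!: derivative_eq_intros simp: has_real_derivative_iff_has_vector_derivative[symmetric])+
  then have "((\<lambda>\<theta>. cos \<theta> *\<^sub>R partial_deriv (1, 0) f (x, 0) + sin \<theta> *\<^sub>R partial_deriv (0, 1) f (x, 0))
      has_integral 0 *\<^sub>R partial_deriv (1, 0) f (x, 0) + 0 *\<^sub>R partial_deriv (0, 1) f (x, 0)) {0..2 * pi}"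
    by (intro has_integral_add has_integral_scaleR_left) simp_all
  then show ?thesis by (simp add: circle_jet_def integral_unique)
qed

lemma circle_measure_integral:
  fixes h :: "real \<times> real \<Rightarrow> complex"
  assumes h: "continuous_on UNIV h"
  shows "(LINT p|circle_measure. h p) = integral {0..2 * pi} (\<lambda>\<theta>. h (cos \<theta>, sin \<theta>))"
proof -
  have [measurable]: "h \<in> borel_measurable borel" using h by (rule borel_measurable_continuous_onI)
  have cs: "(\<lambda>t :: real. (cos t, sin t)) \<in> borel_measurable borel"
    by (intro borel_measurable_continuous_onI continuous_intros)
  then have cs': "(\<lambda>t :: real. (cos t, sin t)) \<in> borel_measurable (restrict_space lborel {0..<2 * pi})"
    by (intro measurable_restrict_space1) simp
  have cont: "continuous_on {0..2 * pi} (\<lambda>\<theta>. h (cos \<theta>, sin \<theta>))"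
    by (rule continuous_on_compose2[OF h]) (auto intro!: continuous_intros)
  have set_int: "set_integrable lborel {0..<2 * pi} (\<lambda>\<theta>. h (cos \<theta>, sin \<theta>))"
    by (rule set_integrable_subset[OF borel_integrable_atLeastAtMost'[OF cont]]) auto
  have "(LINT p|circle_measure. h p) = (LINT \<theta>|restrict_space lborel {0..<2 * pi}. h (cos \<theta>, sin \<theta>))"
    unfolding circle_measure_def by (rule integral_distr[OF cs']) simp
  also have "\<dots> = (LINT \<theta>:{0..<2 * pi}|lborel. h (cos \<theta>, sin \<theta>))"
    unfolding set_lebesgue_integral_def by (rule integral_restrict_space) simp
  also have "\<dots> = integral {0..<2 * pi} (\<lambda>\<theta>. h (cos \<theta>, sin \<theta>))"
    by (rule set_borel_integral_eq_integral(2)[OF set_int])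
  also have "\<dots> = integral {0..2 * pi} (\<lambda>\<theta>. h (cos \<theta>, sin \<theta>))"
    by (rule integral_subset_negligible) (auto intro: negligible_subset[of "{2 * pi}"])
  finally show ?thesis .
qed

lemma circular_mean_eq_circle_jet:
  assumes "has_all_partials f"
  shows "circular_mean f = circle_jet f 0 0"
proof (intro ext)
  fix x r
  have "f differentiable (at p)" for p
    using assms unfolding has_all_partials_def by (metis empty_subsetI foldr.simps(1) id_apply list.set(1))
  then have "continuous_on UNIV f"
    by (intro continuous_at_imp_continuous_on ballI differentiable_imp_continuous_within) auto
  then have "continuous_on UNIV (\<lambda>p. f (x + r * fst p, r * snd p))"
    by (rule continuous_on_compose2) (auto intro!: continuous_intros)
  from circle_measure_integral[OF this]
  show "circular_mean f x r = circle_jet f 0 0 x r"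
    by (simp add: circular_mean_def circle_jet_def case_prod_unfold scaleR_conv_of_real)
qed

section \<open>The coefficients as iterated transforms\<close>

lemma set_integral_open_interval:
  fixes h :: "real \<Rightarrow> complex"
  assumes "continuous_on {a..b} h"
  shows "set_integrable lborel {a<..<b} h" "(LBINT x:{a<..<b}. h x) = integral {a..b} h"
proof -
  show *: "set_integrable lborel {a<..<b} h"
    by (rule set_integrable_subset[OF borel_integrable_atLeastAtMost'[OF assms]]) auto
  show "(LBINT x:{a<..<b}. h x) = integral {a..b} h"
    using set_borel_integral_eq_integral(2)[OF *] by (simp add: integral_open_interval_real)
qed

text \<open>The integrands of the coefficients are products with quotients whose denominators vanish on the boundary of the
rectangle; inside they cancel and leave a continuous function, which settles both the convergence of the integrals
and their evaluation by the gauge integral.\<close>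

lemma iterated_integral_continuous:
  fixes h H :: "real \<Rightarrow> real \<Rightarrow> complex"
  assumes H: "continuous_on UNIV (\<lambda>(x, r). H x r)"
    and eq: "\<And>x r. 0 < x \<Longrightarrow> x < L \<Longrightarrow> 0 < r \<Longrightarrow> r < R \<Longrightarrow> h x r = H x r"
  shows "iterated_integral_exists L R h"
    and "iterated_integral L R h = integral {0..R} (\<lambda>r. integral {0..L} (\<lambda>x. H x r))"
proof -
  have H': "continuous_on S (\<lambda>p. H (u p) (v p))" if "continuous_on S u" "continuous_on S v"
    for S and u v :: "'a :: topological_space \<Rightarrow> real"
    using continuous_on_compose2[OF H, of S "\<lambda>p. (u p, v p)"] that by (auto intro: continuous_intros)
  have x_int: "set_integrable lborel {0<..<L} (\<lambda>x. h x r)"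
    "(LBINT x:{0<..<L}. h x r) = integral {0..L} (\<lambda>x. H x r)" if r: "r \<in> {0<..<R}" for r
  proof -
    have cont: "continuous_on {0..L} (\<lambda>x. H x r)" by (intro H' continuous_intros)
    show "set_integrable lborel {0<..<L} (\<lambda>x. h x r)"
      using set_integral_open_interval(1)[OF cont] eq r
      by (subst set_integrable_cong[where f' = "\<lambda>x. H x r"]) auto
    show "(LBINT x:{0<..<L}. h x r) = integral {0..L} (\<lambda>x. H x r)"
      using set_integral_open_interval(2)[OF cont] eq r
      by (subst set_lebesgue_integral_cong[where g = "\<lambda>x. H x r"]) auto
  qed
  have "continuous_on {0..R} (\<lambda>r. integral (cbox 0 L) (\<lambda>x. H x r))"
    by (intro integral_continuous_on_param) (auto simp: case_prod_unfold intro!: H' continuous_intros)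
  then have cont: "continuous_on {0..R} (\<lambda>r. integral {0..L} (\<lambda>x. H x r))" by simp
  have r_int: "set_integrable lborel {0<..<R} (\<lambda>r. LBINT x:{0<..<L}. h x r)"
    using set_integral_open_interval(1)[OF cont] x_int(2)
    by (subst set_integrable_cong[where f' = "\<lambda>r. integral {0..L} (\<lambda>x. H x r)"]) auto
  show "iterated_integral L R h = integral {0..R} (\<lambda>r. integral {0..L} (\<lambda>x. H x r))"
    unfolding iterated_integral_def
    using set_integral_open_interval(2)[OF cont] x_int(2)
    by (subst set_lebesgue_integral_cong[where g = "\<lambda>r. integral {0..L} (\<lambda>x. H x r)"]) auto
  have "set_integrable lborel ({0..L} \<times> {0..R}) (\<lambda>(x, r). H x r)"
    unfolding set_integrable_def
    by (intro borel_integrable_compact compact_Times compact_Icc continuous_on_subset[OF H]) auto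
  then have "set_integrable lborel ({0<..<L} \<times> {0<..<R}) (\<lambda>(x, r). H x r)"
    by (rule set_integrable_subset) (auto intro!: borel_open open_Times)
  then have "set_integrable lborel ({0<..<L} \<times> {0<..<R}) (\<lambda>(x, r). h x r)"
    using eq by (subst set_integrable_cong[where f' = "\<lambda>(x, r). H x r"]) auto
  then show "iterated_integral_exists L R h"
    using x_int(1) r_int by (simp add: iterated_integral_exists_def)
qed

lemma sqrt_diff_squares_pos: "0 < x \<Longrightarrow> x < A \<Longrightarrow> 0 < sqrt (A\<^sup>2 - x\<^sup>2)" for x A :: real
  by (simp add: power_strict_mono)

definition chord_cos :: "real \<Rightarrow> nat \<Rightarrow> real \<Rightarrow> real" where
  "chord_cos A k x = cos (real k * (pi / A) * sqrt (A\<^sup>2 - x\<^sup>2))"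

lemma integrand_even_eq:
  assumes "0 < x" "x < L" "0 < r" "r < R"
  shows "integrand_even L R (\<lambda>x r. of_real (i_even L R k l x r)) v x r =
    ((x * chord_cos L k x) * (r * chord_cos R l r)) *\<^sub>R v x r"
proof -
  have "i_even L R k l x r * (r * sqrt (R\<^sup>2 - r\<^sup>2) * (x * sqrt (L\<^sup>2 - x\<^sup>2))) =
      (x * chord_cos L k x) * (r * chord_cos R l r)"
    using sqrt_diff_squares_pos[of x L] sqrt_diff_squares_pos[of r R] assms
    by (simp add: i_even_def chord_cos_def)
  moreover have "integrand_even L R (\<lambda>x r. of_real (i_even L R k l x r)) v x r =
      (i_even L R k l x r * (r * sqrt (R\<^sup>2 - r\<^sup>2) * (x * sqrt (L\<^sup>2 - x\<^sup>2)))) *\<^sub>R v x r"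
    by (simp add: integrand_even_def scaleR_conv_of_real)
  ultimately show ?thesis by (simp only:)
qed

lemma integrand_odd_eq:
  assumes "0 < x" "x < L" "0 < r" "r < R"
  shows "integrand_odd L R (\<lambda>x r. of_real (i_odd L R k l x r)) v x r =
    (chord_cos L k x * (r * chord_cos R l r)) *\<^sub>R v x r"
proof -
  have "i_odd L R k l x r * (r * sqrt (R\<^sup>2 - r\<^sup>2) * (sqrt (L\<^sup>2 - x\<^sup>2) / x)) =
      chord_cos L k x * (r * chord_cos R l r)"
    using sqrt_diff_squares_pos[of x L] sqrt_diff_squares_pos[of r R] assms
    by (simp add: i_odd_def i_even_def chord_cos_def)
  moreover have "integrand_odd L R (\<lambda>x r. of_real (i_odd L R k l x r)) v x r =
      (i_odd L R k l x r * (r * sqrt (R\<^sup>2 - r\<^sup>2) * (sqrt (L\<^sup>2 - x\<^sup>2) / x))) *\<^sub>R v x r"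
    by (simp add: integrand_odd_def scaleR_conv_of_real)
  ultimately show ?thesis by (simp only:)
qed

lemma iterated_integral_eq_chord_transform:
  fixes v :: "real \<Rightarrow> real \<Rightarrow> complex"
  assumes v: "continuous_on UNIV (\<lambda>(x, r). v x r)"
    and h: "\<And>x r. 0 < x \<Longrightarrow> x < L \<Longrightarrow> 0 < r \<Longrightarrow> r < R \<Longrightarrow>
      h x r = ((x * chord_cos L k x) * (r * chord_cos R l r)) *\<^sub>R (2 *\<^sub>R v x r)"
  shows "iterated_integral L R h =
    2 *\<^sub>R chord_transform R l (\<lambda>r. chord_transform L k (\<lambda>x. v x r))"
proof -
  have "continuous_on UNIV (\<lambda>(x, r). ((x * chord_cos L k x) * (r * chord_cos R l r)) *\<^sub>R (2 *\<^sub>R v x r))"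
    using v unfolding case_prod_unfold chord_cos_def by (intro continuous_intros) auto
  from iterated_integral_continuous(2)[OF this h]
  have "iterated_integral L R h = integral {0..R} (\<lambda>r. integral {0..L} (\<lambda>x.
      ((x * chord_cos L k x) * (r * chord_cos R l r)) *\<^sub>R (2 *\<^sub>R v x r)))" .
  also have "\<dots> = integral {0..R} (\<lambda>r. integral {0..L} (\<lambda>x.
      2 *\<^sub>R (r * chord_cos R l r) *\<^sub>R (x * chord_cos L k x) *\<^sub>R v x r))"
    by (simp add: mult_ac)
  also have "\<dots> = 2 *\<^sub>R chord_transform R l (\<lambda>r. chord_transform L k (\<lambda>x. v x r))"
    by (simp only: integral_cmul chord_transform_def chord_cos_def)
  finally show ?thesis .
qed

lemma i_even_eq_chord_kernel:
  assumes "0 < x" "x < L" "0 < r" "r < R"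
  shows "of_real (i_even L R k l x r) *
      (of_real (neumann_number k * neumann_number l / (2 * L * R)) * (2 *\<^sub>R c)) =
    (chord_kernel L k x * chord_kernel R l r) *\<^sub>R (c :: complex)"
proof -
  have "i_even L R k l x r * (neumann_number k * neumann_number l / (2 * L * R)) * 2 =
      chord_kernel L k x * chord_kernel R l r"
    using assms by (simp add: i_even_def chord_kernel_def mult_ac)
  moreover have "of_real (i_even L R k l x r) *
      (of_real (neumann_number k * neumann_number l / (2 * L * R)) * (2 *\<^sub>R c)) =
    (i_even L R k l x r * (neumann_number k * neumann_number l / (2 * L * R)) * 2) *\<^sub>R c"
    by (simp add: scaleR_conv_of_real)
  ultimately show ?thesis by (simp only:)
qed

section \<open>The expansion of the circular mean\<close>

theorem theorem4p2p2:
  fixes R L :: real and f :: "real \<times> real \<Rightarrow> complex" and g :: "real \<Rightarrow> real \<Rightarrow> complex"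
  assumes "R > 0" and "L > 0" and "f \<in> schwartz_space"
    and "g = circular_mean f"
  shows "((\<forall>k l. G_even_well_defined L R g k l) \<and>
          (\<forall>x r. 0 < r \<and> r < R \<and> 0 < x \<and> x < L \<and> (\<forall>y s. g (- y) s = g y s) \<longrightarrow>
             ((\<lambda>(k, l). of_real (i_even L R k l x r) * G_even L R g k l) has_sum g x r) UNIV)) \<and>
         ((\<forall>k l. G_odd_well_defined L R g k l) \<and>
          (\<forall>x r. 0 < r \<and> r < R \<and> 0 < x \<and> x < L \<and> (\<forall>y s. g (- y) s = - g y s) \<longrightarrow>
             ((\<lambda>(k, l). of_real (i_odd L R k l x r) * G_odd L R g k l) has_sum g x r) UNIV))"
proof -
  have f: "has_all_partials f" using assms(3) by (rule schwartz_space_has_all_partials)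
  have jet: "is_jet2 (circle_jet f)" using f by (rule is_jet2_circle_jet)
  have g: "g = circle_jet f 0 0" using assms(4) circular_mean_eq_circle_jet[OF f] by simp
  have cont: "continuous_on S (\<lambda>p. g (u p) (v p))" if "continuous_on S u" "continuous_on S v"
    for S and u v :: "real \<times> real \<Rightarrow> real"
    unfolding g using is_jet2_continuous_on_compose[OF jet that] .
  have "G_even_well_defined L R g k l" for k l
    unfolding G_even_well_defined_def
  proof (rule iterated_integral_continuous(1)[OF _ integrand_even_eq])
    show "continuous_on UNIV (\<lambda>(x, r). ((x * chord_cos L k x) * (r * chord_cos R l r)) *\<^sub>R (g x r + g (- x) r))"
      unfolding case_prod_unfold chord_cos_def by (intro continuous_intros cont)
  qed
  moreover have "G_odd_well_defined L R g k l" for k l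
    unfolding G_odd_well_defined_def
  proof (rule iterated_integral_continuous(1)[OF _ integrand_odd_eq])
    show "continuous_on UNIV (\<lambda>(x, r). (chord_cos L k x * (r * chord_cos R l r)) *\<^sub>R (g x r - g (- x) r))"
      unfolding case_prod_unfold chord_cos_def by (intro continuous_intros cont)
  qed
  moreover have "((\<lambda>(k, l). of_real (i_even L R k l x r) * G_even L R g k l) has_sum g x r) UNIV"
    if r: "0 < r" "r < R" and x: "0 < x" "x < L" and even: "\<forall>y s. g (- y) s = g y s" for x r
  proof -
    have "((\<lambda>(k, l). (chord_kernel L k x * chord_kernel R l r) *\<^sub>R
        chord_transform R l (\<lambda>r. chord_transform L k (\<lambda>x. g x r))) has_sum g x r) UNIV"
      unfolding g
      using is_jet2_even_imp_deriv_zero[OF jet] even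
      by (intro chord_double_series_has_sum assms(1,2) jet x r circle_jet_radial_deriv_zero) (simp add: g)
    moreover have "G_even L R g k l = of_real (neumann_number k * neumann_number l / (2 * L * R)) *
        (2 *\<^sub>R chord_transform R l (\<lambda>r. chord_transform L k (\<lambda>x. g x r)))" for k l
    proof -
      have "scalar_even L R (\<lambda>x r. of_real (i_even L R k l x r)) (\<lambda>x r. g x r + g (- x) r) =
          2 *\<^sub>R chord_transform R l (\<lambda>r. chord_transform L k (\<lambda>x. g x r))"
        unfolding scalar_even_def
      proof (rule iterated_integral_eq_chord_transform)
        show "continuous_on UNIV (\<lambda>(x, r). g x r)"
          unfolding case_prod_unfold by (intro cont continuous_intros)
        show "integrand_even L R (\<lambda>x r. of_real (i_even L R k l x r)) (\<lambda>x r. g x r + g (- x) r) x r =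
            ((x * chord_cos L k x) * (r * chord_cos R l r)) *\<^sub>R (2 *\<^sub>R g x r)"
          if "0 < x" "x < L" "0 < r" "r < R" for x r
          using integrand_even_eq[OF that] even by (simp add: scaleR_2)
      qed
      then show ?thesis by (simp add: G_even_def)
    qed
    ultimately show ?thesis
      by (simp only: i_even_eq_chord_kernel[OF x r])
  qed
  moreover have "((\<lambda>(k, l). of_real (i_odd L R k l x r) * G_odd L R g k l) has_sum g x r) UNIV"
    if r: "0 < r" "r < R" and x: "0 < x" "x < L" and odd: "\<forall>y s. g (- y) s = - g y s" for x r
  proof -
    \<comment> \<open>The odd expansion is the even one for \<open>g x r / x\<close>, which by Hadamard's lemma is a ray average of the circular mean of the \<open>x\<close>-derivative of \<open>f\<close>.\<close>
    define \<Psi> where "\<Psi> = circle_jet (partial_deriv (1, 0) f)"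
    have \<Psi>: "is_jet2 \<Psi>"
      unfolding \<Psi>_def
      by (intro is_jet2_circle_jet has_all_partials_partial_deriv f unit_vectors_in_Basis)
    define \<Phi> where "\<Phi> = (\<lambda>i j x r. ray_average (\<lambda>i x. \<Psi> i j x r) i x)"
    have \<Phi>: "is_jet2 \<Phi>" unfolding \<Phi>_def by (rule is_jet2_ray_average[OF \<Psi>])
    have g_eq: "g x r = x *\<^sub>R \<Phi> 0 0 x r" for x r
    proof -
      have "x *\<^sub>R ray_average (\<lambda>i x. circle_jet f (Suc i) 0 x r) 0 x = circle_jet f 0 0 x r - circle_jet f 0 0 0 r"
        using hadamard_lemma[of "\<lambda>i x. circle_jet f i 0 x r"] jet by (simp add: is_jet2_def)
      moreover have "ray_average (\<lambda>i x. circle_jet f (Suc i) 0 x r) 0 x = \<Phi> 0 0 x r"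
        by (simp add: \<Phi>_def \<Psi>_def ray_average_def circle_jet_partial_deriv)
      moreover have "g (- 0) r = - g 0 r" using odd by blast
      ultimately show ?thesis by (simp add: g)
    qed
    have "\<Psi> 0 0 (- x) r = \<Psi> 0 0 x r" for x r
      using is_jet_odd_imp_deriv_even[of "\<lambda>i x. circle_jet f i 0 x r" x] jet odd
      by (simp add: \<Psi>_def circle_jet_partial_deriv g is_jet2_def)
    then have even: "\<Phi> 0 0 (- x) r = \<Phi> 0 0 x r" for x r
      by (simp add: \<Phi>_def ray_average_def)
    have "\<Phi> 0 1 x 0 = 0" for x
      by (simp add: \<Phi>_def ray_average_def \<Psi>_def circle_jet_radial_deriv_zero[simplified])
    then have series: "((\<lambda>(k, l). (chord_kernel L k x * chord_kernel R l r) *\<^sub>R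
        chord_transform R l (\<lambda>r. chord_transform L k (\<lambda>x. \<Phi> 0 0 x r))) has_sum \<Phi> 0 0 x r) UNIV"
      using is_jet2_even_imp_deriv_zero[OF \<Phi> even]
      by (intro chord_double_series_has_sum assms(1,2) \<Phi> x r)
    have G: "G_odd L R g k l = of_real (neumann_number k * neumann_number l / (2 * L * R)) *
        (2 *\<^sub>R chord_transform R l (\<lambda>r. chord_transform L k (\<lambda>x. \<Phi> 0 0 x r)))" for k l
    proof -
      have "scalar_odd L R (\<lambda>x r. of_real (i_odd L R k l x r)) (\<lambda>x r. g x r - g (- x) r) =
          2 *\<^sub>R chord_transform R l (\<lambda>r. chord_transform L k (\<lambda>x. \<Phi> 0 0 x r))"
        unfolding scalar_odd_def
      proof (rule iterated_integral_eq_chord_transform)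
        show "continuous_on UNIV (\<lambda>(x, r). \<Phi> 0 0 x r)"
          using \<Phi> by (simp add: is_jet2_def)
        show "integrand_odd L R (\<lambda>x r. of_real (i_odd L R k l x r)) (\<lambda>x r. g x r - g (- x) r) x r =
            ((x * chord_cos L k x) * (r * chord_cos R l r)) *\<^sub>R (2 *\<^sub>R \<Phi> 0 0 x r)"
          if "0 < x" "x < L" "0 < r" "r < R" for x r
        proof -
          have "g x r - g (- x) r = 2 *\<^sub>R (x *\<^sub>R \<Phi> 0 0 x r)"
            using odd by (simp add: scaleR_2 flip: g_eq)
          then show ?thesis
            by (simp only: integrand_odd_eq[OF that]) (simp add: mult_ac)
        qed
      qed
      then show ?thesis by (simp add: G_odd_def)
    qed
    have "((\<lambda>(k, l). of_real (i_even L R k l x r) * G_odd L R g k l) has_sum \<Phi> 0 0 x r) UNIV"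
      using series by (simp only: G i_even_eq_chord_kernel[OF x r])
    from has_sum_scaleR[OF this, of x] show ?thesis
      by (simp add: g_eq i_odd_def case_prod_unfold scaleR_conv_of_real mult_ac)
  qed
  ultimately show ?thesis by blast
qed

end
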